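(* Let $(\mathcal T,\otimes,\mathbf 1)$ be a tensor triangulated category which has only a set of radical thick tensor ideals, and let $\mathrm{Zar}(\mathcal T)$ be the frame of radical thick tensor ideals of $\mathcal T$ (ordered by inclusion). Then the support $$\mathcal T\longrightarrow\mathrm{Zar}(\mathcal T),\qquad a\longmapsto\sqrt a$$ is initial among supports on $\mathcal T$.
   Context: A tensor triangulated category is a triangulated category with a symmetric monoidal structure $\otimes$ with unit $\mathbf 1$ such that tensoring with any object is exact (triangulated). A thick tensor ideal is a full triangulated subcategory closed under finite sums and direct summands, and closed under tensoring with arbitrary objects of $\mathcal T$. It is radical if $a^{\otimes n}\in I$ for some $n\in\mathbb N$ implies $a\in I$. $\sqrt a$ is the radical $\{x\mid\exists n,\ x^{\otimes n}\in\langle a\rangle\}$ of the smallest thick tensor ideal $\langle a\rangle$ containing $a$. A frame is a complete lattice in which finite meets distribute over arbitrary joins; frame maps preserve finite meets and arbitrary joins. A support on $\mathcal T$ is a pair $(F,d)$ with $F$ a frame and $d:\mathrm{obj}(\mathcal T)\to F$ a map such that: (1) $d(0)=0$ (bottom) and $d(\mathbf 1)=1$ (top); (2) $d(\Sigma a)=d(a)$; (3) $d(a\oplus b)=d(a)\vee d(b)$; (4) $d(a\otimes b)=d(a)\wedge d(b)$; (5) for every triangle $a\to b\to c\to\Sigma a$, $d(b)\le d(a)\vee d(c)$. A morphism of supports $(F,d)\to(F',d')$ is a frame map $u:F\to F'$ with $u\circ d=d'$. The radical thick tensor ideals do form a frame, and $a\mapsto\sqrt a$ is a support. *)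

theory Defs
  imports "HOL-Algebra.Group"
begin

section \<open>Categories, functors, natural isomorphisms\<close>

record ('o, 'm) cat =
  Obj :: "'o set"
  Arr :: "'m set"
  Dom :: "'m \<Rightarrow> 'o"
  Cod :: "'m \<Rightarrow> 'o"
  Ident :: "'o \<Rightarrow> 'm"
  Comp :: "'m \<Rightarrow> 'm \<Rightarrow> 'm"  (infixl \<open>\<cdot>\<index>\<close> 60)

definition Hom :: "('o, 'm, 'x) cat_scheme \<Rightarrow> 'o \<Rightarrow> 'o \<Rightarrow> 'm set" where
  "Hom C a b = {f \<in> Arr C. Dom C f = a \<and> Cod C f = b}"

locale category =
  fixes C :: "('o, 'm, 'x) cat_scheme" (structure)
  assumes Dom_closed: "f \<in> Arr C \<Longrightarrow> Dom C f \<in> Obj C"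
    and Cod_closed: "f \<in> Arr C \<Longrightarrow> Cod C f \<in> Obj C"
    and Ident_closed: "a \<in> Obj C \<Longrightarrow> Ident C a \<in> Hom C a a"
    and Comp_closed: "\<lbrakk>f \<in> Hom C a b; g \<in> Hom C b c\<rbrakk> \<Longrightarrow> g \<cdot> f \<in> Hom C a c"
    and Comp_Ident_left: "f \<in> Hom C a b \<Longrightarrow> Ident C b \<cdot> f = f"
    and Comp_Ident_right: "f \<in> Hom C a b \<Longrightarrow> f \<cdot> Ident C a = f"
    and Comp_assoc: "\<lbrakk>f \<in> Hom C a b; g \<in> Hom C b c; h \<in> Hom C c d\<rbrakk>
                       \<Longrightarrow> (h \<cdot> g) \<cdot> f = h \<cdot> (g \<cdot> f)"

definition iso_arrow :: "('o, 'm, 'x) cat_scheme \<Rightarrow> 'm \<Rightarrow> bool" where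
  "iso_arrow C f \<longleftrightarrow> f \<in> Arr C \<and>
     (\<exists>g \<in> Hom C (Cod C f) (Dom C f).
        g \<cdot>\<^bsub>C\<^esub> f = Ident C (Dom C f) \<and> f \<cdot>\<^bsub>C\<^esub> g = Ident C (Cod C f))"

definition isomorphic :: "('o, 'm, 'x) cat_scheme \<Rightarrow> 'o \<Rightarrow> 'o \<Rightarrow> bool" where
  "isomorphic C a b \<longleftrightarrow> (\<exists>f \<in> Hom C a b. iso_arrow C f)"

definition cat_functor ::
  "('o, 'm, 'x) cat_scheme \<Rightarrow> ('p, 'n, 'y) cat_scheme \<Rightarrow> ('o \<Rightarrow> 'p) \<Rightarrow> ('m \<Rightarrow> 'n) \<Rightarrow> bool" where
  "cat_functor C D Fo Fm \<longleftrightarrow>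
     (\<forall>a \<in> Obj C. Fo a \<in> Obj D \<and> Fm (Ident C a) = Ident D (Fo a)) \<and>
     (\<forall>a b. \<forall>f \<in> Hom C a b. Fm f \<in> Hom D (Fo a) (Fo b)) \<and>
     (\<forall>a b c. \<forall>f \<in> Hom C a b. \<forall>g \<in> Hom C b c. Fm (g \<cdot>\<^bsub>C\<^esub> f) = Fm g \<cdot>\<^bsub>D\<^esub> Fm f)"

definition natural_iso ::
  "('o, 'm, 'x) cat_scheme \<Rightarrow> ('p, 'n, 'y) cat_scheme \<Rightarrow> ('o \<Rightarrow> 'p) \<Rightarrow> ('m \<Rightarrow> 'n) \<Rightarrow>
     ('o \<Rightarrow> 'p) \<Rightarrow> ('m \<Rightarrow> 'n) \<Rightarrow> ('o \<Rightarrow> 'n) \<Rightarrow> bool" where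
  "natural_iso C D Fo Fm Go Gm \<theta> \<longleftrightarrow>
     (\<forall>a \<in> Obj C. \<theta> a \<in> Hom D (Fo a) (Go a) \<and> iso_arrow D (\<theta> a)) \<and>
     (\<forall>a b. \<forall>f \<in> Hom C a b. \<theta> b \<cdot>\<^bsub>D\<^esub> Fm f = Gm f \<cdot>\<^bsub>D\<^esub> \<theta> a)"

definition equivalence_functor ::
  "('o, 'm, 'x) cat_scheme \<Rightarrow> ('p, 'n, 'y) cat_scheme \<Rightarrow> ('o \<Rightarrow> 'p) \<Rightarrow> ('m \<Rightarrow> 'n) \<Rightarrow> bool" where
  "equivalence_functor C D Fo Fm \<longleftrightarrow> cat_functor C D Fo Fm \<and>
     (\<forall>a \<in> Obj C. \<forall>b \<in> Obj C. bij_betw Fm (Hom C a b) (Hom D (Fo a) (Fo b))) \<and>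
     (\<forall>d \<in> Obj D. \<exists>a \<in> Obj C. isomorphic D (Fo a) d)"


section \<open>Additive categories\<close>

record ('o, 'm) add_cat = "('o, 'm) cat" +
  Plus :: "'m \<Rightarrow> 'm \<Rightarrow> 'm"
  Zero :: "'o \<Rightarrow> 'o \<Rightarrow> 'm"

definition Hom_group :: "('o, 'm, 'x) add_cat_scheme \<Rightarrow> 'o \<Rightarrow> 'o \<Rightarrow> 'm monoid" where
  "Hom_group C a b = \<lparr>carrier = Hom C a b, mult = Plus C, one = Zero C a b\<rparr>"

definition Neg :: "('o, 'm, 'x) add_cat_scheme \<Rightarrow> 'm \<Rightarrow> 'm" where
  "Neg C f = inv\<^bsub>Hom_group C (Dom C f) (Cod C f)\<^esub> f"

definition zero_object :: "('o, 'm, 'x) cat_scheme \<Rightarrow> 'o \<Rightarrow> bool" where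
  "zero_object C z \<longleftrightarrow> z \<in> Obj C \<and>
     (\<forall>a \<in> Obj C. (\<exists>!f. f \<in> Hom C a z) \<and> (\<exists>!f. f \<in> Hom C z a))"

text \<open>\<open>biproduct C a b c\<close> says that \<open>c\<close> is a direct sum of \<open>a\<close> and \<open>b\<close>.  Direct sums are
  only determined up to isomorphism, so no particular choice of them is part of the data.\<close>

definition biproduct :: "('o, 'm, 'x) add_cat_scheme \<Rightarrow> 'o \<Rightarrow> 'o \<Rightarrow> 'o \<Rightarrow> bool" where
  "biproduct C a b c \<longleftrightarrow> a \<in> Obj C \<and> b \<in> Obj C \<and> c \<in> Obj C \<and>
     (\<exists>i \<in> Hom C a c. \<exists>j \<in> Hom C b c. \<exists>p \<in> Hom C c a. \<exists>q \<in> Hom C c b.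
        p \<cdot>\<^bsub>C\<^esub> i = Ident C a \<and> q \<cdot>\<^bsub>C\<^esub> j = Ident C b \<and>
        p \<cdot>\<^bsub>C\<^esub> j = Zero C b a \<and> q \<cdot>\<^bsub>C\<^esub> i = Zero C a b \<and>
        Plus C (i \<cdot>\<^bsub>C\<^esub> p) (j \<cdot>\<^bsub>C\<^esub> q) = Ident C c)"

locale additive_category = category C
  for C :: "('o, 'm, 'x) add_cat_scheme" (structure) +
  assumes Hom_comm_group:
      "\<lbrakk>a \<in> Obj C; b \<in> Obj C\<rbrakk> \<Longrightarrow> comm_group (Hom_group C a b)"
    and Comp_Plus_left: "\<lbrakk>f \<in> Hom C a b; g \<in> Hom C b c; g' \<in> Hom C b c\<rbrakk>
                           \<Longrightarrow> Plus C g g' \<cdot> f = Plus C (g \<cdot> f) (g' \<cdot> f)"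
    and Comp_Plus_right: "\<lbrakk>f \<in> Hom C a b; f' \<in> Hom C a b; g \<in> Hom C b c\<rbrakk>
                           \<Longrightarrow> g \<cdot> Plus C f f' = Plus C (g \<cdot> f) (g \<cdot> f')"
    and zero_object_exists: "\<exists>z. zero_object C z"
    and biproduct_exists: "\<lbrakk>a \<in> Obj C; b \<in> Obj C\<rbrakk> \<Longrightarrow> \<exists>c. biproduct C a b c"

definition additive_functor ::
  "('o, 'm, 'x) add_cat_scheme \<Rightarrow> ('p, 'n, 'y) add_cat_scheme \<Rightarrow> ('o \<Rightarrow> 'p) \<Rightarrow> ('m \<Rightarrow> 'n) \<Rightarrow> bool"
  where
  "additive_functor C D Fo Fm \<longleftrightarrow> cat_functor C D Fo Fm \<and>
     (\<forall>a b. \<forall>f \<in> Hom C a b. \<forall>g \<in> Hom C a b. Fm (Plus C f g) = Plus D (Fm f) (Fm g))"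


section \<open>Triangulated categories\<close>

text \<open>A triangle \<open>a \<rightarrow> b \<rightarrow> c \<rightarrow> \<Sigma> a\<close> is recorded by its three arrows; \<open>Triangles\<close> is the class
  of distinguished triangles.\<close>

record ('o, 'm) tri_cat = "('o, 'm) add_cat" +
  Susp_obj :: "'o \<Rightarrow> 'o"
  Susp_arr :: "'m \<Rightarrow> 'm"
  Triangles :: "('m \<times> 'm \<times> 'm) set"

definition distinguished ::
  "('o, 'm, 'x) tri_cat_scheme \<Rightarrow> 'o \<Rightarrow> 'o \<Rightarrow> 'o \<Rightarrow> 'm \<Rightarrow> 'm \<Rightarrow> 'm \<Rightarrow> bool" where
  "distinguished C a b c f g h \<longleftrightarrow> f \<in> Hom C a b \<and> g \<in> Hom C b c \<and> h \<in> Hom C c (Susp_obj C a) \<and>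
     (f, g, h) \<in> Triangles C"

text \<open>Verdier's axioms; the last one is the octahedral axiom.\<close>

locale triangulated_category = additive_category C
  for C :: "('o, 'm, 'x) tri_cat_scheme" (structure) +
  assumes Susp_equivalence: "equivalence_functor C C (Susp_obj C) (Susp_arr C)"
    and Susp_additive: "additive_functor C C (Susp_obj C) (Susp_arr C)"
    and Triangles_typed: "(f, g, h) \<in> Triangles C \<Longrightarrow> \<exists>a b c. distinguished C a b c f g h"
    and Triangles_iso:
      "\<lbrakk>distinguished C a b c f g h;
        f' \<in> Hom C a' b'; g' \<in> Hom C b' c'; h' \<in> Hom C c' (Susp_obj C a');
        u \<in> Hom C a a'; v \<in> Hom C b b'; w \<in> Hom C c c';
        iso_arrow C u; iso_arrow C v; iso_arrow C w;
        v \<cdot> f = f' \<cdot> u; w \<cdot> g = g' \<cdot> v; Susp_arr C u \<cdot> h = h' \<cdot> w\<rbrakk>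
       \<Longrightarrow> distinguished C a' b' c' f' g' h'"
    and Triangles_Ident:
      "\<lbrakk>a \<in> Obj C; zero_object C z\<rbrakk>
       \<Longrightarrow> distinguished C a a z (Ident C a) (Zero C a z) (Zero C z (Susp_obj C a))"
    and Triangles_cone: "f \<in> Hom C a b \<Longrightarrow> \<exists>c g h. distinguished C a b c f g h"
    and Triangles_rotate:
      "\<lbrakk>f \<in> Hom C a b; g \<in> Hom C b c; h \<in> Hom C c (Susp_obj C a)\<rbrakk>
       \<Longrightarrow> distinguished C a b c f g h \<longleftrightarrow>
           distinguished C b c (Susp_obj C a) g h (Neg C (Susp_arr C f))"
    and Triangles_fill:
      "\<lbrakk>distinguished C a b c f g h; distinguished C a' b' c' f' g' h';
        u \<in> Hom C a a'; v \<in> Hom C b b'; v \<cdot> f = f' \<cdot> u\<rbrakk>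
       \<Longrightarrow> \<exists>w \<in> Hom C c c'. w \<cdot> g = g' \<cdot> v \<and> Susp_arr C u \<cdot> h = h' \<cdot> w"
    and Triangles_octahedral:
      "\<lbrakk>distinguished C a b x f f' f''; distinguished C b c z g g' g'';
        distinguished C a c y (g \<cdot> f) h' h''\<rbrakk>
       \<Longrightarrow> \<exists>u v. distinguished C x y z u v (Susp_arr C f' \<cdot> g'') \<and>
             u \<cdot> f' = h' \<cdot> g \<and> h'' \<cdot> u = f'' \<and>
             v \<cdot> h' = g' \<and> g'' \<cdot> v = Susp_arr C f \<cdot> h''"

definition exact_functor ::
  "('o, 'm, 'x) tri_cat_scheme \<Rightarrow> ('p, 'n, 'y) tri_cat_scheme \<Rightarrow> ('o \<Rightarrow> 'p) \<Rightarrow> ('m \<Rightarrow> 'n) \<Rightarrow> bool"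
  where
  "exact_functor C D Fo Fm \<longleftrightarrow> additive_functor C D Fo Fm \<and>
     (\<exists>\<theta>. natural_iso C D (Fo \<circ> Susp_obj C) (Fm \<circ> Susp_arr C) (Susp_obj D \<circ> Fo) (Susp_arr D \<circ> Fm) \<theta> \<and>
          (\<forall>a b c f g h. distinguished C a b c f g h \<longrightarrow>
             distinguished D (Fo a) (Fo b) (Fo c) (Fm f) (Fm g) (\<theta> a \<cdot>\<^bsub>D\<^esub> Fm h)))"


section \<open>Tensor triangulated categories\<close>

record ('o, 'm) tt_cat = "('o, 'm) tri_cat" +
  Unit :: "'o"
  Tensor_obj :: "'o \<Rightarrow> 'o \<Rightarrow> 'o"  (infixr \<open>\<otimes>\<^sub>o\<index>\<close> 70)
  Tensor_arr :: "'m \<Rightarrow> 'm \<Rightarrow> 'm"  (infixr \<open>\<otimes>\<^sub>a\<index>\<close> 70)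
  Assoc :: "'o \<Rightarrow> 'o \<Rightarrow> 'o \<Rightarrow> 'm"
  Left_unit :: "'o \<Rightarrow> 'm"
  Right_unit :: "'o \<Rightarrow> 'm"
  Braid :: "'o \<Rightarrow> 'o \<Rightarrow> 'm"

locale symmetric_monoidal_category = category T
  for T :: "('o, 'm, 'x) tt_cat_scheme" (structure) +
  assumes Unit_closed: "Unit T \<in> Obj T"
    and Tensor_obj_closed: "\<lbrakk>a \<in> Obj T; b \<in> Obj T\<rbrakk> \<Longrightarrow> a \<otimes>\<^sub>o b \<in> Obj T"
    and Tensor_arr_closed: "\<lbrakk>f \<in> Hom T a b; g \<in> Hom T c d\<rbrakk> \<Longrightarrow> f \<otimes>\<^sub>a g \<in> Hom T (a \<otimes>\<^sub>o c) (b \<otimes>\<^sub>o d)"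
    and Tensor_Ident: "\<lbrakk>a \<in> Obj T; b \<in> Obj T\<rbrakk> \<Longrightarrow> Ident T a \<otimes>\<^sub>a Ident T b = Ident T (a \<otimes>\<^sub>o b)"
    and Tensor_Comp:
      "\<lbrakk>f \<in> Hom T a b; f' \<in> Hom T b c; g \<in> Hom T d e; g' \<in> Hom T e k\<rbrakk>
       \<Longrightarrow> (f' \<cdot> f) \<otimes>\<^sub>a (g' \<cdot> g) = (f' \<otimes>\<^sub>a g') \<cdot> (f \<otimes>\<^sub>a g)"
    and Assoc_closed: "\<lbrakk>a \<in> Obj T; b \<in> Obj T; c \<in> Obj T\<rbrakk>
       \<Longrightarrow> Assoc T a b c \<in> Hom T ((a \<otimes>\<^sub>o b) \<otimes>\<^sub>o c) (a \<otimes>\<^sub>o (b \<otimes>\<^sub>o c))"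
    and Assoc_iso: "\<lbrakk>a \<in> Obj T; b \<in> Obj T; c \<in> Obj T\<rbrakk> \<Longrightarrow> iso_arrow T (Assoc T a b c)"
    and Assoc_natural:
      "\<lbrakk>f \<in> Hom T a a'; g \<in> Hom T b b'; h \<in> Hom T c c'\<rbrakk>
       \<Longrightarrow> Assoc T a' b' c' \<cdot> ((f \<otimes>\<^sub>a g) \<otimes>\<^sub>a h) = (f \<otimes>\<^sub>a (g \<otimes>\<^sub>a h)) \<cdot> Assoc T a b c"
    and Left_unit_closed: "a \<in> Obj T \<Longrightarrow> Left_unit T a \<in> Hom T (Unit T \<otimes>\<^sub>o a) a"
    and Left_unit_iso: "a \<in> Obj T \<Longrightarrow> iso_arrow T (Left_unit T a)"
    and Left_unit_natural:
      "f \<in> Hom T a b \<Longrightarrow> Left_unit T b \<cdot> (Ident T (Unit T) \<otimes>\<^sub>a f) = f \<cdot> Left_unit T a"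
    and Right_unit_closed: "a \<in> Obj T \<Longrightarrow> Right_unit T a \<in> Hom T (a \<otimes>\<^sub>o Unit T) a"
    and Right_unit_iso: "a \<in> Obj T \<Longrightarrow> iso_arrow T (Right_unit T a)"
    and Right_unit_natural:
      "f \<in> Hom T a b \<Longrightarrow> Right_unit T b \<cdot> (f \<otimes>\<^sub>a Ident T (Unit T)) = f \<cdot> Right_unit T a"
    and Braid_closed: "\<lbrakk>a \<in> Obj T; b \<in> Obj T\<rbrakk> \<Longrightarrow> Braid T a b \<in> Hom T (a \<otimes>\<^sub>o b) (b \<otimes>\<^sub>o a)"
    and Braid_natural:
      "\<lbrakk>f \<in> Hom T a a'; g \<in> Hom T b b'\<rbrakk> \<Longrightarrow> Braid T a' b' \<cdot> (f \<otimes>\<^sub>a g) = (g \<otimes>\<^sub>a f) \<cdot> Braid T a b"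
    and Braid_symmetric:
      "\<lbrakk>a \<in> Obj T; b \<in> Obj T\<rbrakk> \<Longrightarrow> Braid T b a \<cdot> Braid T a b = Ident T (a \<otimes>\<^sub>o b)"
    and pentagon:
      "\<lbrakk>a \<in> Obj T; b \<in> Obj T; c \<in> Obj T; d \<in> Obj T\<rbrakk>
       \<Longrightarrow> Assoc T a b (c \<otimes>\<^sub>o d) \<cdot> Assoc T (a \<otimes>\<^sub>o b) c d =
           (Ident T a \<otimes>\<^sub>a Assoc T b c d) \<cdot> (Assoc T a (b \<otimes>\<^sub>o c) d \<cdot> (Assoc T a b c \<otimes>\<^sub>a Ident T d))"
    and unit_triangle:
      "\<lbrakk>a \<in> Obj T; b \<in> Obj T\<rbrakk>
       \<Longrightarrow> (Ident T a \<otimes>\<^sub>a Left_unit T b) \<cdot> Assoc T a (Unit T) b = Right_unit T a \<otimes>\<^sub>a Ident T b"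
    and hexagon:
      "\<lbrakk>a \<in> Obj T; b \<in> Obj T; c \<in> Obj T\<rbrakk>
       \<Longrightarrow> Assoc T b c a \<cdot> (Braid T a (b \<otimes>\<^sub>o c) \<cdot> Assoc T a b c) =
           (Ident T b \<otimes>\<^sub>a Braid T a c) \<cdot> (Assoc T b a c \<cdot> (Braid T a b \<otimes>\<^sub>a Ident T c))"

text \<open>By the braiding, exactness of \<open>a \<otimes> -\<close> is the same as exactness of \<open>- \<otimes> a\<close>.\<close>

locale tensor_triangulated_category =
  triangulated_category T + symmetric_monoidal_category T
  for T :: "('o, 'm, 'x) tt_cat_scheme" (structure) +
  assumes Tensor_exact:
    "a \<in> Obj T \<Longrightarrow> exact_functor T T (\<lambda>b. a \<otimes>\<^sub>o b) (\<lambda>f. Ident T a \<otimes>\<^sub>a f)"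


section \<open>Radical thick tensor ideals\<close>

text \<open>Full subcategories are given by their sets of objects.\<close>

definition triangulated_subcategory :: "('o, 'm, 'x) tri_cat_scheme \<Rightarrow> 'o set \<Rightarrow> bool" where
  "triangulated_subcategory C I \<longleftrightarrow> I \<subseteq> Obj C \<and>
     (\<forall>z. zero_object C z \<longrightarrow> z \<in> I) \<and>
     (\<forall>a b. a \<in> I \<and> isomorphic C a b \<longrightarrow> b \<in> I) \<and>
     (\<forall>a \<in> Obj C. Susp_obj C a \<in> I \<longleftrightarrow> a \<in> I) \<and>
     (\<forall>a b c f g h. distinguished C a b c f g h \<and> a \<in> I \<and> b \<in> I \<longrightarrow> c \<in> I)"

definition thick_tensor_ideal :: "('o, 'm, 'x) tt_cat_scheme \<Rightarrow> 'o set \<Rightarrow> bool" where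
  "thick_tensor_ideal T I \<longleftrightarrow> triangulated_subcategory T I \<and>
     (\<forall>a b c. biproduct T a b c \<and> a \<in> I \<and> b \<in> I \<longrightarrow> c \<in> I) \<and>
     (\<forall>a b c. biproduct T a b c \<and> c \<in> I \<longrightarrow> a \<in> I) \<and>
     (\<forall>a \<in> Obj T. \<forall>b \<in> I. a \<otimes>\<^sub>o\<^bsub>T\<^esub> b \<in> I)"

text \<open>Allowing the exponent \<open>0\<close> below is harmless: an ideal containing \<open>Unit T\<close> contains every
  object.\<close>

primrec tensor_power :: "('o, 'm, 'x) tt_cat_scheme \<Rightarrow> 'o \<Rightarrow> nat \<Rightarrow> 'o" where
  "tensor_power T a 0 = Unit T"
| "tensor_power T a (Suc n) = a \<otimes>\<^sub>o\<^bsub>T\<^esub> tensor_power T a n"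

definition radical_thick_tensor_ideal :: "('o, 'm, 'x) tt_cat_scheme \<Rightarrow> 'o set \<Rightarrow> bool" where
  "radical_thick_tensor_ideal T I \<longleftrightarrow> thick_tensor_ideal T I \<and>
     (\<forall>a \<in> Obj T. (\<exists>n. tensor_power T a n \<in> I) \<longrightarrow> a \<in> I)"

definition generated_ideal :: "('o, 'm, 'x) tt_cat_scheme \<Rightarrow> 'o \<Rightarrow> 'o set" where
  "generated_ideal T a = \<Inter>{I. thick_tensor_ideal T I \<and> a \<in> I}"

definition radical :: "('o, 'm, 'x) tt_cat_scheme \<Rightarrow> 'o \<Rightarrow> 'o set" where
  "radical T a = {x \<in> Obj T. \<exists>n. tensor_power T x n \<in> generated_ideal T a}"

text \<open>The radical thick tensor ideals are sets over the type of objects, so they form a set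
  without any further assumption on \<open>T\<close>.\<close>

definition Zar :: "('o, 'm, 'x) tt_cat_scheme \<Rightarrow> 'o set gorder" where
  "Zar T = \<lparr>carrier = {I. radical_thick_tensor_ideal T I}, eq = (=), le = (\<subseteq>)\<rparr>"


section \<open>Frames and supports\<close>

locale frame = complete_lattice L for L (structure) +
  assumes meet_Sup_distrib:
    "\<lbrakk>x \<in> carrier L; A \<subseteq> carrier L\<rbrakk> \<Longrightarrow> x \<sqinter> \<Squnion>A = \<Squnion>((\<lambda>y. x \<sqinter> y) ` A)"

text \<open>Frame maps are taken extensional, i.e. \<open>undefined\<close> off the carrier, so that equality of
  HOL functions is equality of maps between the carriers.  The finite meets and the joins include
  the empty ones.\<close>

definition frame_map ::
  "('f, 'x) gorder_scheme \<Rightarrow> ('g, 'y) gorder_scheme \<Rightarrow> ('f \<Rightarrow> 'g) \<Rightarrow> bool" where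
  "frame_map F G u \<longleftrightarrow> frame F \<and> frame G \<and> u \<in> carrier F \<rightarrow>\<^sub>E carrier G \<and>
     (\<forall>A. finite A \<and> A \<subseteq> carrier F \<longrightarrow> u (\<Sqinter>\<^bsub>F\<^esub>A) = \<Sqinter>\<^bsub>G\<^esub>(u ` A)) \<and>
     (\<forall>A. A \<subseteq> carrier F \<longrightarrow> u (\<Squnion>\<^bsub>F\<^esub>A) = \<Squnion>\<^bsub>G\<^esub>(u ` A))"

locale tt_support = tensor_triangulated_category T + F?: frame F
  for T :: "('o, 'm, 'x) tt_cat_scheme" (structure) and F :: "('f, 'y) gorder_scheme" (structure)
    and d :: "'o \<Rightarrow> 'f" +
  assumes supp_closed: "a \<in> Obj T \<Longrightarrow> d a \<in> carrier F"
    and supp_zero: "zero_object T z \<Longrightarrow> d z = \<bottom>\<^bsub>F\<^esub>"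
    and supp_Unit: "d (Unit T) = \<top>\<^bsub>F\<^esub>"
    and supp_Susp: "a \<in> Obj T \<Longrightarrow> d (Susp_obj T a) = d a"
    and supp_biproduct: "biproduct T a b c \<Longrightarrow> d c = d a \<squnion>\<^bsub>F\<^esub> d b"
    and supp_Tensor: "\<lbrakk>a \<in> Obj T; b \<in> Obj T\<rbrakk> \<Longrightarrow> d (a \<otimes>\<^sub>o\<^bsub>T\<^esub> b) = d a \<sqinter>\<^bsub>F\<^esub> d b"
    and supp_triangle: "distinguished T a b c f g h \<Longrightarrow> d b \<sqsubseteq>\<^bsub>F\<^esub> d a \<squnion>\<^bsub>F\<^esub> d c"

definition support_morphism ::
  "('o, 'm, 'x) tt_cat_scheme \<Rightarrow> ('f, 'y) gorder_scheme \<Rightarrow> ('o \<Rightarrow> 'f) \<Rightarrow>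
     ('g, 'z) gorder_scheme \<Rightarrow> ('o \<Rightarrow> 'g) \<Rightarrow> ('f \<Rightarrow> 'g) \<Rightarrow> bool" where
  "support_morphism T F d F' d' u \<longleftrightarrow> frame_map F F' u \<and> (\<forall>a \<in> Obj T. u (d a) = d' a)"

end

theory Submission
  imports Defs
begin

text \<open>
  The frame law of \<open>Zar T\<close> holds because for a radical ideal \<open>M\<close> the objects \<open>y\<close> with
  \<open>x \<otimes> y \<in> M\<close> again form a radical ideal: if \<open>x\<close> lies in \<open>K\<close> and in the join of a family of
  ideals, comparing that join with this ideal for the join \<open>M\<close> of the meets gives \<open>x \<otimes> x \<in> M\<close>,
  hence \<open>x \<in> M\<close>.

  For a support \<open>d\<close> with values in \<open>F\<close> and \<open>f \<in> F\<close>, the objects \<open>a\<close> with \<open>d a \<le> f\<close> form a radical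
  ideal.  This gives a map \<open>F \<rightarrow> Zar T\<close> whose left adjoint \<open>J \<mapsto> \<Squnion> (d ` J)\<close> is the required frame map;
  it preserves binary meets by distributivity in \<open>F\<close> and \<open>d (a \<otimes> b) = d a \<sqinter> d b\<close>.  It is unique
  since every radical ideal is the join of the radicals of its elements.
\<close>

section \<open>Isomorphism classes of objects\<close>

context category
begin

lemma Hom_Obj: "f \<in> Hom C a b \<Longrightarrow> a \<in> Obj C" "f \<in> Hom C a b \<Longrightarrow> b \<in> Obj C"
  using Dom_closed Cod_closed by (auto simp: Hom_def)

lemma isomorphic_iff:
  "isomorphic C a b \<longleftrightarrow>
     (\<exists>f \<in> Hom C a b. \<exists>g \<in> Hom C b a. g \<cdot> f = Ident C a \<and> f \<cdot> g = Ident C b)"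
  by (auto simp: isomorphic_def iso_arrow_def Hom_def)

lemma isomorphicI:
  "\<lbrakk>f \<in> Hom C a b; g \<in> Hom C b a; g \<cdot> f = Ident C a; f \<cdot> g = Ident C b\<rbrakk> \<Longrightarrow> isomorphic C a b"
  unfolding isomorphic_iff by blast

lemma isomorphic_refl: "a \<in> Obj C \<Longrightarrow> isomorphic C a a"
  by (meson isomorphicI Ident_closed Comp_Ident_left)

lemma isomorphic_sym: "isomorphic C a b \<Longrightarrow> isomorphic C b a"
  unfolding isomorphic_iff by blast

lemma isomorphic_trans:
  assumes "isomorphic C a b" "isomorphic C b c"
  shows "isomorphic C a c"
proof -
  obtain f g where f: "f \<in> Hom C a b" "g \<in> Hom C b a" "g \<cdot> f = Ident C a" "f \<cdot> g = Ident C b"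
    using assms(1) unfolding isomorphic_iff by blast
  obtain h k where h: "h \<in> Hom C b c" "k \<in> Hom C c b" "k \<cdot> h = Ident C b" "h \<cdot> k = Ident C c"
    using assms(2) unfolding isomorphic_iff by blast
  have "(g \<cdot> k) \<cdot> (h \<cdot> f) = g \<cdot> ((k \<cdot> h) \<cdot> f)"
    using Comp_assoc[OF Comp_closed[OF f(1) h(1)] h(2) f(2)] Comp_assoc[OF f(1) h(1,2)] by simp
  then have 1: "(g \<cdot> k) \<cdot> (h \<cdot> f) = Ident C a"
    using f h by (simp add: Comp_Ident_left)
  have "(h \<cdot> f) \<cdot> (g \<cdot> k) = h \<cdot> ((f \<cdot> g) \<cdot> k)"
    using Comp_assoc[OF Comp_closed[OF h(2) f(2)] f(1) h(1)] Comp_assoc[OF h(2) f(2,1)] by simp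
  then have "(h \<cdot> f) \<cdot> (g \<cdot> k) = Ident C c"
    using f h by (simp add: Comp_Ident_left)
  with 1 show ?thesis
    using f h by (meson isomorphicI Comp_closed)
qed

lemma isomorphic_Obj: "isomorphic C a b \<Longrightarrow> a \<in> Obj C" "isomorphic C a b \<Longrightarrow> b \<in> Obj C"
  using Hom_Obj by (auto simp: isomorphic_iff)

end

text \<open>Ideals are closed under isomorphism, so they only see classes of objects. Passing to
  classes turns coherence isomorphisms into equations that the simplifier can use.\<close>

definition iso_class :: "('o, 'm, 'x) cat_scheme \<Rightarrow> 'o \<Rightarrow> 'o set" where
  "iso_class C a = {b. isomorphic C a b}"

lemma (in category) iso_class_eq_iff:
  "a \<in> Obj C \<Longrightarrow> iso_class C a = iso_class C b \<longleftrightarrow> isomorphic C a b"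
  unfolding iso_class_def set_eq_iff mem_Collect_eq
  by (meson isomorphic_Obj isomorphic_refl isomorphic_sym isomorphic_trans)

text \<open>The product is a union over all representatives, so none has to be chosen;
  \<open>iso_class_tensor\<close> shows that all the classes in the union coincide.\<close>

definition iso_monoid :: "('o, 'm, 'x) tt_cat_scheme \<Rightarrow> 'o set monoid" where
  "iso_monoid T = \<lparr>carrier = iso_class T ` Obj T,
     mult = (\<lambda>A B. \<Union>a\<in>A. \<Union>b\<in>B. iso_class T (a \<otimes>\<^sub>o\<^bsub>T\<^esub> b)), one = iso_class T (Unit T)\<rparr>"

context symmetric_monoidal_category
begin

lemma isomorphic_tensor:
  assumes "isomorphic T a a'" "isomorphic T b b'"
  shows "isomorphic T (a \<otimes>\<^sub>o b) (a' \<otimes>\<^sub>o b')"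
proof -
  obtain f f' where f: "f \<in> Hom T a a'" "f' \<in> Hom T a' a" "f' \<cdot> f = Ident T a" "f \<cdot> f' = Ident T a'"
    using assms(1) unfolding isomorphic_iff by blast
  obtain g g' where g: "g \<in> Hom T b b'" "g' \<in> Hom T b' b" "g' \<cdot> g = Ident T b" "g \<cdot> g' = Ident T b'"
    using assms(2) unfolding isomorphic_iff by blast
  note o = isomorphic_Obj[OF assms(1)] isomorphic_Obj[OF assms(2)]
  show ?thesis
  proof (rule isomorphicI)
    show "(f' \<otimes>\<^sub>a g') \<cdot> (f \<otimes>\<^sub>a g) = Ident T (a \<otimes>\<^sub>o b)"
      using Tensor_Comp[OF f(1,2) g(1,2)] f g o by (simp add: Tensor_Ident)
    show "(f \<otimes>\<^sub>a g) \<cdot> (f' \<otimes>\<^sub>a g') = Ident T (a' \<otimes>\<^sub>o b')"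
      using Tensor_Comp[OF f(2,1) g(2,1)] f g o by (simp add: Tensor_Ident)
  qed (use f g in \<open>auto intro: Tensor_arr_closed\<close>)
qed

lemma iso_class_carrier: "a \<in> Obj T \<Longrightarrow> iso_class T a \<in> carrier (iso_monoid T)"
  by (simp add: iso_monoid_def)

lemma iso_class_Unit: "iso_class T (Unit T) = \<one>\<^bsub>iso_monoid T\<^esub>"
  by (simp add: iso_monoid_def)

lemma iso_class_tensor:
  assumes "a \<in> Obj T" "b \<in> Obj T"
  shows "iso_class T (a \<otimes>\<^sub>o b) = iso_class T a \<otimes>\<^bsub>iso_monoid T\<^esub> iso_class T b"
proof -
  have eq: "iso_class T (x \<otimes>\<^sub>o y) = iso_class T (a \<otimes>\<^sub>o b)"
    if "x \<in> iso_class T a" "y \<in> iso_class T b" for x y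
    using that iso_class_eq_iff isomorphic_tensor[of a x b y] assms
    by (metis Tensor_obj_closed iso_class_def mem_Collect_eq)
  have "a \<in> iso_class T a" "b \<in> iso_class T b"
    using assms by (auto simp: iso_class_def isomorphic_refl)
  then have "(\<Union>x\<in>iso_class T a. \<Union>y\<in>iso_class T b. iso_class T (x \<otimes>\<^sub>o y)) = iso_class T (a \<otimes>\<^sub>o b)"
    using eq by blast
  then show ?thesis
    by (simp add: iso_monoid_def)
qed

lemma isomorphic_arrow: "\<lbrakk>f \<in> Hom T a b; iso_arrow T f\<rbrakk> \<Longrightarrow> isomorphic T a b"
  unfolding isomorphic_def by blast

text \<open>The arrows \<open>Assoc\<close>, \<open>Braid\<close> and \<open>Left_unit\<close> give
  the monoid laws. From here on, every rebracketing or permutation of tensor factors is a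
  computation with \<open>iso.m_ac\<close> and the power laws.\<close>

sublocale iso: comm_monoid "iso_monoid T"
proof (rule comm_monoidI)
  have ex: "\<exists>a \<in> Obj T. x = iso_class T a" if "x \<in> carrier (iso_monoid T)" for x
    using that by (auto simp: iso_monoid_def)
  fix x y z assume "x \<in> carrier (iso_monoid T)" "y \<in> carrier (iso_monoid T)"
    "z \<in> carrier (iso_monoid T)"
  then obtain a b c where o: "a \<in> Obj T" "b \<in> Obj T" "c \<in> Obj T"
    and x: "x = iso_class T a" "y = iso_class T b" "z = iso_class T c"
    using ex by metis
  show "x \<otimes>\<^bsub>iso_monoid T\<^esub> y \<otimes>\<^bsub>iso_monoid T\<^esub> z = x \<otimes>\<^bsub>iso_monoid T\<^esub> (y \<otimes>\<^bsub>iso_monoid T\<^esub> z)"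
    using o isomorphic_arrow[OF Assoc_closed Assoc_iso]
    by (simp add: x iso_class_tensor[symmetric] Tensor_obj_closed iso_class_eq_iff)
next
  have ex: "\<exists>a \<in> Obj T. x = iso_class T a" if "x \<in> carrier (iso_monoid T)" for x
    using that by (auto simp: iso_monoid_def)
  fix x y assume "x \<in> carrier (iso_monoid T)" "y \<in> carrier (iso_monoid T)"
  then obtain a b where o: "a \<in> Obj T" "b \<in> Obj T"
    and x: "x = iso_class T a" "y = iso_class T b"
    using ex by metis
  show "x \<otimes>\<^bsub>iso_monoid T\<^esub> y \<in> carrier (iso_monoid T)"
    using o by (simp add: x iso_class_tensor[symmetric] Tensor_obj_closed iso_class_carrier)
  have "isomorphic T (a \<otimes>\<^sub>o b) (b \<otimes>\<^sub>o a)"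
    using o by (meson isomorphicI Braid_closed Braid_symmetric)
  then show "x \<otimes>\<^bsub>iso_monoid T\<^esub> y = y \<otimes>\<^bsub>iso_monoid T\<^esub> x"
    using o by (simp add: x iso_class_tensor[symmetric] Tensor_obj_closed iso_class_eq_iff)
  show "\<one>\<^bsub>iso_monoid T\<^esub> \<otimes>\<^bsub>iso_monoid T\<^esub> x = x"
    using o isomorphic_arrow[OF Left_unit_closed Left_unit_iso]
    by (simp add: x iso_class_tensor[symmetric] iso_class_Unit[symmetric] Tensor_obj_closed
        Unit_closed iso_class_eq_iff)
qed (simp add: Unit_closed iso_class_carrier iso_class_Unit[symmetric])

lemma tensor_power_closed: "a \<in> Obj T \<Longrightarrow> tensor_power T a n \<in> Obj T"
  by (induction n) (simp_all add: Unit_closed Tensor_obj_closed)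

lemma iso_class_tensor_power:
  "a \<in> Obj T \<Longrightarrow> iso_class T (tensor_power T a n) = iso_class T a [^]\<^bsub>iso_monoid T\<^esub> n"
  by (induction n)
    \<comment> \<open>\<open>tensor_power\<close> adds the new factor on the left, the monoid power
      on the right; hence commutativity.\<close>
    (simp_all add: iso_class_Unit iso_class_tensor tensor_power_closed iso_class_carrier iso.m_comm)

lemmas iso_class_simps = iso_class_tensor iso_class_Unit iso_class_tensor_power
  iso_class_carrier Tensor_obj_closed Unit_closed tensor_power_closed

end

section \<open>Additive structure\<close>

context additive_category
begin

lemma Zero_Hom: "\<lbrakk>a \<in> Obj C; b \<in> Obj C\<rbrakk> \<Longrightarrow> Zero C a b \<in> Hom C a b"
  using comm_group.axioms(2)[OF Hom_comm_group, of a b] monoid.one_closed[of "Hom_group C a b"]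
  by (simp add: Hom_group_def group.is_monoid)

lemma Plus_Zero: "f \<in> Hom C a b \<Longrightarrow> Plus C f (Zero C a b) = f"
  using comm_group.axioms(2)[OF Hom_comm_group, of a b] Hom_Obj[of f a b]
    monoid.r_one[of "Hom_group C a b" f]
  by (simp add: Hom_group_def group.is_monoid)

lemma Plus_comm: "\<lbrakk>f \<in> Hom C a b; g \<in> Hom C a b\<rbrakk> \<Longrightarrow> Plus C f g = Plus C g f"
  using comm_monoid.m_comm[of "Hom_group C a b" f g]
    comm_group.axioms(1)[OF Hom_comm_group, of a b] Hom_Obj[of f a b]
  by (simp add: Hom_group_def)

text \<open>By cancellation in the Hom group. Anything compatible with addition sends a zero arrow
  to an arrow \<open>f\<close> with \<open>f + f = f\<close>, so this identifies the image as
  zero.\<close>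

lemma Plus_idem: "\<lbrakk>f \<in> Hom C a b; Plus C f f = f\<rbrakk> \<Longrightarrow> f = Zero C a b"
  using group.l_cancel_one[of "Hom_group C a b" f f]
    comm_group.axioms(2)[OF Hom_comm_group, of a b] Hom_Obj[of f a b]
  by (simp add: Hom_group_def)

lemma Comp_Zero:
  assumes "f \<in> Hom C a b" "c \<in> Obj C"
  shows "Zero C b c \<cdot> f = Zero C a c"
proof (rule Plus_idem)
  have z: "Zero C b c \<in> Hom C b c"
    using assms Hom_Obj Zero_Hom by blast
  then show "Zero C b c \<cdot> f \<in> Hom C a c"
    using assms Comp_closed by blast
  show "Plus C (Zero C b c \<cdot> f) (Zero C b c \<cdot> f) = Zero C b c \<cdot> f"
    using Comp_Plus_left[OF assms(1) z z] Plus_Zero[OF z] by simp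
qed

lemma biproduct_sym:
  assumes "biproduct C a b c"
  shows "biproduct C b a c"
proof -
  obtain i j p q where *: "i \<in> Hom C a c" "j \<in> Hom C b c" "p \<in> Hom C c a" "q \<in> Hom C c b"
    "p \<cdot> i = Ident C a" "q \<cdot> j = Ident C b" "p \<cdot> j = Zero C b a" "q \<cdot> i = Zero C a b"
    "Plus C (i \<cdot> p) (j \<cdot> q) = Ident C c"
    using assms unfolding biproduct_def by blast
  have "Plus C (j \<cdot> q) (i \<cdot> p) = Ident C c"
    using * Plus_comm[of "j \<cdot> q" c c "i \<cdot> p"] Comp_closed by metis
  then show ?thesis
    using assms * unfolding biproduct_def by blast
qed

text \<open>The axioms of a support do not mention isomorphisms. Presenting an isomorphic copy of
  \<open>a\<close> as a direct sum of \<open>a\<close> and a zero object lets the axiom for direct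
  sums apply.\<close>

lemma biproduct_zero_object:
  assumes "isomorphic C a b" "zero_object C z"
  shows "biproduct C a z b"
proof -
  obtain f g where f: "f \<in> Hom C a b" "g \<in> Hom C b a" "g \<cdot> f = Ident C a" "f \<cdot> g = Ident C b"
    using assms(1) unfolding isomorphic_iff by blast
  have o: "a \<in> Obj C" "b \<in> Obj C" "z \<in> Obj C"
    using assms isomorphic_Obj by (auto simp: zero_object_def)
  have to: "u = v" if "u \<in> Hom C x z" "v \<in> Hom C x z" for u v x
    using assms(2) that Hom_Obj unfolding zero_object_def by blast
  have from_z: "u = v" if "u \<in> Hom C z x" "v \<in> Hom C z x" for u v x
    using assms(2) that Hom_Obj unfolding zero_object_def by blast
  let ?j = "Zero C z b" and ?q = "Zero C b z"
  have j: "?j \<in> Hom C z b" "?q \<in> Hom C b z"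
    using o by (auto intro: Zero_Hom)
  \<comment> \<open>Each equation compares two arrows into or out of the zero object.\<close>
  have "?q \<cdot> ?j = Ident C z" "g \<cdot> ?j = Zero C z a" "?q \<cdot> f = Zero C a z"
    by (meson j o f to from_z Comp_closed Ident_closed Zero_Hom)+
  moreover have "?j \<cdot> ?q = Zero C b b"
    using Comp_Zero j o by blast
  then have "Plus C (f \<cdot> g) (?j \<cdot> ?q) = Ident C b"
    using f o Plus_Zero[OF Ident_closed] by simp
  ultimately show ?thesis
    unfolding biproduct_def using f j o by blast
qed

end

text \<open>A biproduct is a system of equations between arrows, and an additive functor preserves
  them all once it is known to preserve zero arrows.\<close>

lemma additive_functor_biproduct:
  assumes "additive_functor C D Fo Fm" "additive_category C" "additive_category D" "biproduct C a b c"
  shows "biproduct D (Fo a) (Fo b) (Fo c)"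
proof -
  interpret C: additive_category C by fact
  interpret D: additive_category D by fact
  have F: "cat_functor C D Fo Fm"
    and Plus: "\<And>f g a b. \<lbrakk>f \<in> Hom C a b; g \<in> Hom C a b\<rbrakk> \<Longrightarrow> Fm (Plus C f g) = Plus D (Fm f) (Fm g)"
    using assms(1) unfolding additive_functor_def by blast+
  have Hom: "Fm f \<in> Hom D (Fo a) (Fo b)" if "f \<in> Hom C a b" for f a b
    using F that unfolding cat_functor_def by blast
  have Comp: "Fm (g \<cdot>\<^bsub>C\<^esub> f) = Fm g \<cdot>\<^bsub>D\<^esub> Fm f" if "f \<in> Hom C a b" "g \<in> Hom C b c" for f g a b c
    using F that unfolding cat_functor_def by blast
  have Obj: "Fo a \<in> Obj D" "Fm (Ident C a) = Ident D (Fo a)" if "a \<in> Obj C" for a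
    using F that unfolding cat_functor_def by blast+
  have Zero: "Fm (Zero C a b) = Zero D (Fo a) (Fo b)" if "a \<in> Obj C" "b \<in> Obj C" for a b
    using that C.Zero_Hom C.Plus_Zero Hom Plus D.Plus_idem by metis
  obtain i j p q where *: "i \<in> Hom C a c" "j \<in> Hom C b c" "p \<in> Hom C c a" "q \<in> Hom C c b"
    "p \<cdot>\<^bsub>C\<^esub> i = Ident C a" "q \<cdot>\<^bsub>C\<^esub> j = Ident C b" "p \<cdot>\<^bsub>C\<^esub> j = Zero C b a" "q \<cdot>\<^bsub>C\<^esub> i = Zero C a b"
    "Plus C (i \<cdot>\<^bsub>C\<^esub> p) (j \<cdot>\<^bsub>C\<^esub> q) = Ident C c"
    and o: "a \<in> Obj C" "b \<in> Obj C" "c \<in> Obj C"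
    using assms(4) unfolding biproduct_def by blast
  have "Fm p \<cdot>\<^bsub>D\<^esub> Fm i = Ident D (Fo a)" "Fm q \<cdot>\<^bsub>D\<^esub> Fm j = Ident D (Fo b)"
    "Fm p \<cdot>\<^bsub>D\<^esub> Fm j = Zero D (Fo b) (Fo a)" "Fm q \<cdot>\<^bsub>D\<^esub> Fm i = Zero D (Fo a) (Fo b)"
    "Plus D (Fm i \<cdot>\<^bsub>D\<^esub> Fm p) (Fm j \<cdot>\<^bsub>D\<^esub> Fm q) = Ident D (Fo c)"
    using * o Comp Obj Zero Plus by (metis C.Comp_closed)+
  then show ?thesis
    unfolding biproduct_def using Obj(1) Hom * o by blast
qed

section \<open>Radical thick tensor ideals\<close>

context tensor_triangulated_category
begin

text \<open>Exactness twists the third arrow by a natural isomorphism. Ideals depend only on the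
  vertices of a triangle, so the arrows are left existential.\<close>

lemma tensor_distinguished:
  assumes "distinguished T a b c f g h" "w \<in> Obj T"
  shows "\<exists>f g h. distinguished T (w \<otimes>\<^sub>o a) (w \<otimes>\<^sub>o b) (w \<otimes>\<^sub>o c) f g h"
  using Tensor_exact[OF assms(2)] assms(1) unfolding exact_functor_def by blast

lemma tensor_biproduct:
  assumes "biproduct T a b c" "w \<in> Obj T"
  shows "biproduct T (w \<otimes>\<^sub>o a) (w \<otimes>\<^sub>o b) (w \<otimes>\<^sub>o c)"
  using additive_functor_biproduct[OF _ additive_category_axioms additive_category_axioms assms(1)]
    Tensor_exact[OF assms(2)] unfolding exact_functor_def by blast

lemma Susp_closed: "a \<in> Obj T \<Longrightarrow> Susp_obj T a \<in> Obj T"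
  using Susp_additive unfolding additive_functor_def cat_functor_def by blast

lemma tensor_Susp:
  assumes "w \<in> Obj T" "a \<in> Obj T"
  shows "isomorphic T (w \<otimes>\<^sub>o Susp_obj T a) (Susp_obj T (w \<otimes>\<^sub>o a))"
proof -
  obtain \<theta> where "natural_iso T T ((\<lambda>b. w \<otimes>\<^sub>o b) \<circ> Susp_obj T) ((\<lambda>f. Ident T w \<otimes>\<^sub>a f) \<circ> Susp_arr T)
      (Susp_obj T \<circ> (\<lambda>b. w \<otimes>\<^sub>o b)) (Susp_arr T \<circ> (\<lambda>f. Ident T w \<otimes>\<^sub>a f)) \<theta>"
    using Tensor_exact[OF assms(1)] unfolding exact_functor_def by blast
  then show ?thesis
    using assms(2) isomorphic_arrow[of "\<theta> a"] unfolding natural_iso_def by auto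
qed

lemma distinguished_Obj:
  assumes "distinguished T a b c f g h"
  shows "a \<in> Obj T" "b \<in> Obj T" "c \<in> Obj T"
  using assms Hom_Obj by (auto simp: distinguished_def)

lemma distinguished_rotate:
  "distinguished T a b c f g h \<Longrightarrow> \<exists>k. distinguished T b c (Susp_obj T a) g h k"
  using Triangles_rotate unfolding distinguished_def by blast

section \<open>Closure properties of thick tensor ideals\<close>

lemma thick_tensor_idealI:
  assumes "I \<subseteq> Obj T"
    and "\<And>z. zero_object T z \<Longrightarrow> z \<in> I"
    and "\<And>a b. \<lbrakk>a \<in> I; isomorphic T a b\<rbrakk> \<Longrightarrow> b \<in> I"
    and "\<And>a. a \<in> Obj T \<Longrightarrow> Susp_obj T a \<in> I \<longleftrightarrow> a \<in> I"
    and "\<And>a b c f g h. \<lbrakk>distinguished T a b c f g h; a \<in> I; b \<in> I\<rbrakk> \<Longrightarrow> c \<in> I"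
    and "\<And>a b c. \<lbrakk>biproduct T a b c; a \<in> I; b \<in> I\<rbrakk> \<Longrightarrow> c \<in> I"
    and "\<And>a b c. \<lbrakk>biproduct T a b c; c \<in> I\<rbrakk> \<Longrightarrow> a \<in> I"
    and "\<And>a b. \<lbrakk>a \<in> Obj T; b \<in> I\<rbrakk> \<Longrightarrow> a \<otimes>\<^sub>o b \<in> I"
  shows "thick_tensor_ideal T I"
  using assms unfolding thick_tensor_ideal_def triangulated_subcategory_def by blast

lemma ideal_Obj: "\<lbrakk>thick_tensor_ideal T I; a \<in> I\<rbrakk> \<Longrightarrow> a \<in> Obj T"
  and ideal_zero: "\<lbrakk>thick_tensor_ideal T I; zero_object T z\<rbrakk> \<Longrightarrow> z \<in> I"
  and ideal_iso: "\<lbrakk>thick_tensor_ideal T I; a \<in> I; isomorphic T a b\<rbrakk> \<Longrightarrow> b \<in> I"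
  and ideal_Susp: "\<lbrakk>thick_tensor_ideal T I; a \<in> Obj T\<rbrakk> \<Longrightarrow> Susp_obj T a \<in> I \<longleftrightarrow> a \<in> I"
  and ideal_triangle:
    "\<lbrakk>thick_tensor_ideal T I; distinguished T a b c f g h; a \<in> I; b \<in> I\<rbrakk> \<Longrightarrow> c \<in> I"
  and ideal_biproduct: "\<lbrakk>thick_tensor_ideal T I; biproduct T a b c; a \<in> I; b \<in> I\<rbrakk> \<Longrightarrow> c \<in> I"
  and ideal_summand: "\<lbrakk>thick_tensor_ideal T I; biproduct T a b c; c \<in> I\<rbrakk> \<Longrightarrow> a \<in> I"
  and ideal_tensor: "\<lbrakk>thick_tensor_ideal T I; a \<in> Obj T; b \<in> I\<rbrakk> \<Longrightarrow> a \<otimes>\<^sub>o b \<in> I"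
  unfolding thick_tensor_ideal_def triangulated_subcategory_def by blast+

text \<open>The bridge from computations in \<open>iso_monoid T\<close> to membership in an
  ideal.\<close>

lemma ideal_cong:
  assumes "thick_tensor_ideal T I" "a \<in> Obj T" "b \<in> Obj T" "iso_class T a = iso_class T b"
  shows "a \<in> I \<longleftrightarrow> b \<in> I"
  using assms ideal_iso iso_class_eq_iff isomorphic_sym by metis

lemma ideal_tensor': "\<lbrakk>thick_tensor_ideal T I; a \<in> Obj T; b \<in> I\<rbrakk> \<Longrightarrow> b \<otimes>\<^sub>o a \<in> I"
  using ideal_cong[of I "b \<otimes>\<^sub>o a" "a \<otimes>\<^sub>o b"] ideal_tensor ideal_Obj
  by (simp add: iso_class_simps iso.m_comm)

text \<open>The definition of an ideal controls the third vertex of a triangle. Two rotations make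
  \<open>Susp_obj T b\<close> the third vertex, and suspension can be undone inside an
  ideal.\<close>

lemma ideal_middle:
  assumes I: "thick_tensor_ideal T I" and d: "distinguished T a b c f g h" and "a \<in> I" "c \<in> I"
  shows "b \<in> I"
proof -
  obtain k l where "distinguished T b c (Susp_obj T a) g h k"
    "distinguished T c (Susp_obj T a) (Susp_obj T b) h k l"
    using d distinguished_rotate by blast
  then show ?thesis
    using assms ideal_triangle ideal_Susp distinguished_Obj by metis
qed

lemma thick_tensor_ideal_Obj: "thick_tensor_ideal T (Obj T)"
  by (rule thick_tensor_idealI)
    (auto simp: zero_object_def biproduct_def Susp_closed Tensor_obj_closed isomorphic_Obj distinguished_Obj)

text \<open>The family must be nonempty because \<open>\<Inter>{}\<close> is the whole type of
  objects, which may exceed \<open>Obj T\<close>.\<close>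

lemma thick_tensor_ideal_Inter:
  assumes "\<And>I. I \<in> A \<Longrightarrow> thick_tensor_ideal T I" "A \<noteq> {}"
  shows "thick_tensor_ideal T (\<Inter>A)"
proof (rule thick_tensor_idealI)
  show "\<Inter>A \<subseteq> Obj T"
    using assms ideal_Obj by blast
qed (use assms in \<open>blast intro: ideal_zero ideal_iso ideal_triangle ideal_biproduct ideal_summand
      ideal_tensor dest: ideal_Susp\<close>)+

lemma thick_generated_ideal:
  assumes "a \<in> Obj T"
  shows "thick_tensor_ideal T (generated_ideal T a)" "a \<in> generated_ideal T a"
  unfolding generated_ideal_def
  using assms thick_tensor_ideal_Obj by (auto intro!: thick_tensor_ideal_Inter)

section \<open>Ideal quotients, usually written \<open>(I : x)\<close>\<close>

definition ideal_quotient :: "'o set \<Rightarrow> 'o \<Rightarrow> 'o set" where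
  "ideal_quotient I x = {y \<in> Obj T. x \<otimes>\<^sub>o y \<in> I}"

text \<open>Tensoring with \<open>x\<close> carries triangles, direct sums and suspensions to the
  same kind of data, up to isomorphism, so each closure property of \<open>I\<close> pulls
  back.\<close>

lemma thick_ideal_quotient:
  assumes I: "thick_tensor_ideal T I" and x: "x \<in> Obj T"
  shows "thick_tensor_ideal T (ideal_quotient I x)"
proof (rule thick_tensor_idealI)
  fix a b assume "a \<in> ideal_quotient I x" "isomorphic T a b"
  then show "b \<in> ideal_quotient I x"
    unfolding ideal_quotient_def
    using I x by (auto intro: ideal_iso isomorphic_tensor isomorphic_refl isomorphic_Obj)
next
  fix a assume "a \<in> Obj T"
  then show "Susp_obj T a \<in> ideal_quotient I x \<longleftrightarrow> a \<in> ideal_quotient I x"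
    unfolding ideal_quotient_def mem_Collect_eq
    using tensor_Susp[OF x] ideal_iso[OF I] isomorphic_sym ideal_Susp[OF I] Susp_closed
      Tensor_obj_closed x by metis
next
  fix a b c f g h assume "distinguished T a b c f g h" "a \<in> ideal_quotient I x" "b \<in> ideal_quotient I x"
  then show "c \<in> ideal_quotient I x"
    unfolding ideal_quotient_def mem_Collect_eq
    using tensor_distinguished[OF _ x] ideal_triangle[OF I] distinguished_Obj by metis
next
  fix a b c assume "biproduct T a b c" "a \<in> ideal_quotient I x" "b \<in> ideal_quotient I x"
  then show "c \<in> ideal_quotient I x"
    unfolding ideal_quotient_def mem_Collect_eq
    using tensor_biproduct[OF _ x] ideal_biproduct[OF I] by (metis biproduct_def)
next
  fix a b c assume "biproduct T a b c" "c \<in> ideal_quotient I x"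
  then show "a \<in> ideal_quotient I x"
    unfolding ideal_quotient_def mem_Collect_eq
    using tensor_biproduct[OF _ x] ideal_summand[OF I] by (metis biproduct_def)
next
  fix a b assume "a \<in> Obj T" "b \<in> ideal_quotient I x"
  then show "a \<otimes>\<^sub>o b \<in> ideal_quotient I x"
    using x I ideal_cong[OF I, of "x \<otimes>\<^sub>o (a \<otimes>\<^sub>o b)" "a \<otimes>\<^sub>o (x \<otimes>\<^sub>o b)"]
    by (auto simp: ideal_quotient_def iso_class_simps iso.m_lcomm intro: ideal_tensor)
next
  fix z assume "zero_object T z"
  then show "z \<in> ideal_quotient I x"
    \<comment> \<open>As \<open>z\<close> itself lies in \<open>I\<close>, so does its product with
      \<open>x\<close>.\<close>
    using ideal_zero[OF I] ideal_Obj[OF I] ideal_tensor[OF I x] by (simp add: ideal_quotient_def)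
qed (auto simp: ideal_quotient_def)

text \<open>The factors \<open>x\<close> are exchanged for \<open>y\<close> one at a time, with all
  other factors collected in the multiplier to which \<open>step\<close> applies. This will carry
  unary closure properties from ideals to their radicals.\<close>

lemma tensor_power_mem:
  assumes I: "thick_tensor_ideal T I" and o: "x \<in> Obj T" "y \<in> Obj T"
    and step: "\<And>w. \<lbrakk>w \<in> Obj T; w \<otimes>\<^sub>o x \<in> I\<rbrakk> \<Longrightarrow> w \<otimes>\<^sub>o y \<in> I"
  shows "\<lbrakk>w \<in> Obj T; w \<otimes>\<^sub>o tensor_power T x n \<in> I\<rbrakk> \<Longrightarrow> w \<otimes>\<^sub>o tensor_power T y n \<in> I"
proof (induction n arbitrary: w)
  case (Suc n)
  have "(w \<otimes>\<^sub>o x) \<otimes>\<^sub>o tensor_power T x n \<in> I"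
    using ideal_cong[OF I, of "w \<otimes>\<^sub>o tensor_power T x (Suc n)" "(w \<otimes>\<^sub>o x) \<otimes>\<^sub>o tensor_power T x n"]
      Suc.prems o by (simp add: iso_class_simps iso.m_assoc)
  then have "(w \<otimes>\<^sub>o x) \<otimes>\<^sub>o tensor_power T y n \<in> I"
    using Suc.IH[of "w \<otimes>\<^sub>o x"] Suc.prems o Tensor_obj_closed by blast
  then have "(w \<otimes>\<^sub>o tensor_power T y n) \<otimes>\<^sub>o x \<in> I"
    using ideal_cong[OF I, of "(w \<otimes>\<^sub>o x) \<otimes>\<^sub>o tensor_power T y n" "(w \<otimes>\<^sub>o tensor_power T y n) \<otimes>\<^sub>o x"]
      Suc.prems o by (simp add: iso_class_simps iso.m_ac)
  then have "(w \<otimes>\<^sub>o tensor_power T y n) \<otimes>\<^sub>o y \<in> I"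
    using step Suc.prems o by (simp add: Tensor_obj_closed tensor_power_closed)
  then show ?case
    using ideal_cong[OF I, of "(w \<otimes>\<^sub>o tensor_power T y n) \<otimes>\<^sub>o y" "w \<otimes>\<^sub>o tensor_power T y (Suc n)"]
      Suc.prems o by (simp add: iso_class_simps iso.m_ac)
qed simp

text \<open>Keeping \<open>w\<close> general lets the induction move one factor \<open>x\<close> or \<open>y\<close> into \<open>w\<close> at a time; the
  case of interest is \<open>w = Unit T\<close>.\<close>

lemma tensor_power_mem2:
  assumes I: "thick_tensor_ideal T I" and o: "x \<in> Obj T" "y \<in> Obj T" "z \<in> Obj T"
    and step: "\<And>w. \<lbrakk>w \<in> Obj T; w \<otimes>\<^sub>o x \<in> I; w \<otimes>\<^sub>o y \<in> I\<rbrakk> \<Longrightarrow> w \<otimes>\<^sub>o z \<in> I"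
  shows "\<lbrakk>w \<in> Obj T; w \<otimes>\<^sub>o tensor_power T x m \<in> I; w \<otimes>\<^sub>o tensor_power T y n \<in> I\<rbrakk>
    \<Longrightarrow> w \<otimes>\<^sub>o tensor_power T z (m + n) \<in> I"
\<comment> \<open>As in the binomial argument for nilpotent elements: passing from \<open>w\<close>
  to \<open>w \<otimes> x\<close> or to \<open>w \<otimes> y\<close> lowers one of the two exponents
  and so the sum.\<close>
proof (induction "m + n" arbitrary: w m n)
  case 0
  then show ?case by simp
next
  case (Suc k)
  note c = ideal_cong[OF I]
  \<comment> \<open>If one exponent is 0, the hypothesis puts \<open>w\<close>, up to isomorphism,
    into \<open>I\<close>, and all its multiples follow.\<close>
  have power_0: "w \<otimes>\<^sub>o tensor_power T z (m + n) \<in> I" if "w \<otimes>\<^sub>o Unit T \<in> I"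
    using that Suc.prems(1) o ideal_tensor'[OF I _ that, of "tensor_power T z (m + n)"]
      c[of "(w \<otimes>\<^sub>o Unit T) \<otimes>\<^sub>o tensor_power T z (m + n)" "w \<otimes>\<^sub>o tensor_power T z (m + n)"]
    by (simp add: iso_class_simps)
  show ?case
  proof (cases "m = 0 \<or> n = 0")
    case True
    then show ?thesis using power_0 Suc.prems by auto
  next
    case False
    then obtain m' n' where mn: "m = Suc m'" "n = Suc n'"
      by (metis old.nat.exhaust)
    let ?Z = "tensor_power T z k"
    have cls: "iso_class T ((w \<otimes>\<^sub>o u) \<otimes>\<^sub>o v) = iso_class T (w \<otimes>\<^sub>o u \<otimes>\<^sub>o v)"
      "iso_class T ((w \<otimes>\<^sub>o u) \<otimes>\<^sub>o v) = iso_class T ((w \<otimes>\<^sub>o v) \<otimes>\<^sub>o u)"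
      if "u \<in> Obj T" "v \<in> Obj T" for u v
      using that Suc.prems(1) by (simp_all add: iso_class_simps iso.m_ac)
    have ZO: "?Z \<in> Obj T" "\<And>u n. u \<in> Obj T \<Longrightarrow> tensor_power T u n \<in> Obj T"
      using o by (auto simp: tensor_power_closed)
    \<comment> \<open>The new multiplier takes over one factor of the power of \<open>x\<close>,
      while the hypothesis on the power of \<open>y\<close> survives because \<open>I\<close>
      absorbs \<open>x\<close>.\<close>
    have "(w \<otimes>\<^sub>o x) \<otimes>\<^sub>o ?Z \<in> I"
    proof -
      have "(w \<otimes>\<^sub>o x) \<otimes>\<^sub>o tensor_power T x m' \<in> I"
        using c[of "w \<otimes>\<^sub>o tensor_power T x m"] cls(1)[of x "tensor_power T x m'"] Suc.prems mn o
        by (simp add: Tensor_obj_closed ZO)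
      moreover have "(w \<otimes>\<^sub>o x) \<otimes>\<^sub>o tensor_power T y n \<in> I"
        using c[of "(w \<otimes>\<^sub>o x) \<otimes>\<^sub>o tensor_power T y n" "(w \<otimes>\<^sub>o tensor_power T y n) \<otimes>\<^sub>o x"]
          cls(2)[of x "tensor_power T y n"] ideal_tensor'[OF I o(1) Suc.prems(3)] Suc.prems o ZO
        by (simp add: Tensor_obj_closed)
      ultimately show ?thesis
        using Suc.hyps(1)[of m' n "w \<otimes>\<^sub>o x"] Suc.hyps(2) Suc.prems(1) o mn
        by (simp add: Tensor_obj_closed)
    qed
    moreover have "(w \<otimes>\<^sub>o y) \<otimes>\<^sub>o ?Z \<in> I"
    proof -
      have "(w \<otimes>\<^sub>o y) \<otimes>\<^sub>o tensor_power T y n' \<in> I"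
        using c[of "w \<otimes>\<^sub>o tensor_power T y n"] cls(1)[of y "tensor_power T y n'"] Suc.prems mn o
        by (simp add: Tensor_obj_closed ZO)
      moreover have "(w \<otimes>\<^sub>o y) \<otimes>\<^sub>o tensor_power T x m \<in> I"
        using c[of "(w \<otimes>\<^sub>o y) \<otimes>\<^sub>o tensor_power T x m" "(w \<otimes>\<^sub>o tensor_power T x m) \<otimes>\<^sub>o y"]
          cls(2)[of y "tensor_power T x m"] ideal_tensor'[OF I o(2) Suc.prems(2)] Suc.prems o ZO
        by (simp add: Tensor_obj_closed)
      ultimately show ?thesis
        using Suc.hyps(1)[of m n' "w \<otimes>\<^sub>o y"] Suc.hyps(2) Suc.prems(1) o mn
        by (simp add: Tensor_obj_closed)
    qed
    ultimately have "(w \<otimes>\<^sub>o ?Z) \<otimes>\<^sub>o x \<in> I" "(w \<otimes>\<^sub>o ?Z) \<otimes>\<^sub>o y \<in> I"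
      using c cls(2) o ZO Suc.prems(1) Tensor_obj_closed by meson+
    then have "(w \<otimes>\<^sub>o ?Z) \<otimes>\<^sub>o z \<in> I"
      using step ZO Suc.prems(1) Tensor_obj_closed by blast
    then have "w \<otimes>\<^sub>o (z \<otimes>\<^sub>o ?Z) \<in> I"
      using c[of "w \<otimes>\<^sub>o (z \<otimes>\<^sub>o ?Z)" "(w \<otimes>\<^sub>o ?Z) \<otimes>\<^sub>o z"] cls[of z ?Z] ZO o Suc.prems(1)
      by (simp add: Tensor_obj_closed)
    then show ?thesis
      by (simp flip: Suc.hyps(2))
  qed
qed

section \<open>The radical of a thick tensor ideal\<close>

definition ideal_radical :: "'o set \<Rightarrow> 'o set" where
  "ideal_radical I = {x \<in> Obj T. \<exists>n. tensor_power T x n \<in> I}"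

lemma Unit_tensor_mem:
  "\<lbrakk>thick_tensor_ideal T I; a \<in> Obj T\<rbrakk> \<Longrightarrow> Unit T \<otimes>\<^sub>o a \<in> I \<longleftrightarrow> a \<in> I"
  by (rule ideal_cong) (simp_all add: iso_class_simps)

lemma subset_ideal_radical:
  assumes "thick_tensor_ideal T I"
  shows "I \<subseteq> ideal_radical I"
proof
  fix x assume "x \<in> I"
  \<comment> \<open>The first power is \<open>x \<otimes> Unit T\<close>, not literally
    \<open>x\<close>.\<close>
  then have "x \<in> Obj T" "tensor_power T x 1 \<in> I"
    using assms ideal_Obj ideal_tensor' Unit_closed by auto
  then show "x \<in> ideal_radical I"
    unfolding ideal_radical_def by blast
qed

text \<open>The hypothesis \<open>step\<close> says that every ideal quotient of \<open>I\<close>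
  containing \<open>x\<close> contains \<open>y\<close>. Whatever closure property holds in all
  these ideals therefore passes to the radical.\<close>

lemma ideal_radical_step:
  assumes I: "thick_tensor_ideal T I" and o: "x \<in> ideal_radical I" "y \<in> Obj T"
    and step: "\<And>w. \<lbrakk>w \<in> Obj T; w \<otimes>\<^sub>o x \<in> I\<rbrakk> \<Longrightarrow> w \<otimes>\<^sub>o y \<in> I"
  shows "y \<in> ideal_radical I"
proof -
  obtain n where "x \<in> Obj T" "tensor_power T x n \<in> I"
    using o unfolding ideal_radical_def by blast
  then have "tensor_power T y n \<in> I"
    using tensor_power_mem[OF I _ o(2) step, of x "Unit T" n] Unit_tensor_mem[OF I] o(2)
    by (simp add: Unit_closed tensor_power_closed)
  then show ?thesis
    using o unfolding ideal_radical_def by blast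
qed

lemma ideal_radical_step2:
  assumes I: "thick_tensor_ideal T I" and o: "x \<in> ideal_radical I" "y \<in> ideal_radical I" "z \<in> Obj T"
    and step: "\<And>w. \<lbrakk>w \<in> Obj T; w \<otimes>\<^sub>o x \<in> I; w \<otimes>\<^sub>o y \<in> I\<rbrakk> \<Longrightarrow> w \<otimes>\<^sub>o z \<in> I"
  shows "z \<in> ideal_radical I"
proof -
  obtain m n where "x \<in> Obj T" "tensor_power T x m \<in> I" "y \<in> Obj T" "tensor_power T y n \<in> I"
    using o unfolding ideal_radical_def by blast
  then have "tensor_power T z (m + n) \<in> I"
    using tensor_power_mem2[OF I _ _ o(3) step, of x y "Unit T" m n] Unit_tensor_mem[OF I] o(3)
    by (simp add: Unit_closed tensor_power_closed)
  then show ?thesis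
    using o unfolding ideal_radical_def by blast
qed

text \<open>Each closure property is read off from the ideal quotients of \<open>I\<close> through
  the two step lemmas, so no power of a cone or of a direct sum is ever expanded.\<close>

lemma radical_ideal_radical:
  assumes I: "thick_tensor_ideal T I"
  shows "radical_thick_tensor_ideal T (ideal_radical I)"
proof -
  note q = thick_ideal_quotient[OF I]
  have sub: "a \<in> Obj T" if "a \<in> ideal_radical I" for a
    using that by (simp add: ideal_radical_def)
  have Q: "w \<otimes>\<^sub>o a \<in> I \<longleftrightarrow> a \<in> ideal_quotient I w" if "a \<in> Obj T" for w a
    using that by (simp add: ideal_quotient_def)
  have "thick_tensor_ideal T (ideal_radical I)"
  proof (rule thick_tensor_idealI)
    show "z \<in> ideal_radical I" if "zero_object T z" for z
      using that subset_ideal_radical[OF I] ideal_zero[OF I] by blast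
  next
    fix a b assume "a \<in> ideal_radical I" "isomorphic T a b"
    then show "b \<in> ideal_radical I"
      using ideal_radical_step[OF I] Q sub q ideal_iso isomorphic_Obj by metis
  next
    fix a assume a: "a \<in> Obj T"
    note s = Susp_closed[OF a]
    show "Susp_obj T a \<in> ideal_radical I \<longleftrightarrow> a \<in> ideal_radical I"
      using ideal_radical_step[OF I _ a, of "Susp_obj T a"] ideal_radical_step[OF I _ s, of a]
        Q[OF a] Q[OF s] ideal_Susp[OF q a] by blast
  next
    fix a b c f g h assume *: "distinguished T a b c f g h" "a \<in> ideal_radical I" "b \<in> ideal_radical I"
    then show "c \<in> ideal_radical I"
      using ideal_radical_step2[OF I *(2,3)] Q sub ideal_triangle[OF q *(1)] distinguished_Obj by metis
  next
    fix a b c assume *: "biproduct T a b c" "a \<in> ideal_radical I" "b \<in> ideal_radical I"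
    then have "c \<in> Obj T"
      by (simp add: biproduct_def)
    then show "c \<in> ideal_radical I"
      using ideal_radical_step2[OF I *(2,3)] Q * sub ideal_biproduct[OF q *(1)] by metis
  next
    fix a b c assume *: "biproduct T a b c" "c \<in> ideal_radical I"
    then have "a \<in> Obj T"
      by (simp add: biproduct_def)
    then show "a \<in> ideal_radical I"
      using ideal_radical_step[OF I *(2)] Q * sub ideal_summand[OF q *(1)] by metis
  next
    fix a b assume *: "a \<in> Obj T" "b \<in> ideal_radical I"
    then show "a \<otimes>\<^sub>o b \<in> ideal_radical I"
      using ideal_radical_step[OF I *(2)] Q sub ideal_tensor[OF q *(1)] Tensor_obj_closed by metis
  qed (use sub in blast)
  moreover have "a \<in> ideal_radical I" if a: "a \<in> Obj T" "tensor_power T a n \<in> ideal_radical I" for a n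
  proof -
    obtain m where "tensor_power T (tensor_power T a n) m \<in> I"
      using a unfolding ideal_radical_def by blast
    \<comment> \<open>A power of a power is isomorphic to the power with the product
      exponent.\<close>
    then have "tensor_power T a (n * m) \<in> I"
      using ideal_cong[OF I, of "tensor_power T (tensor_power T a n) m" "tensor_power T a (n * m)"] a
      by (simp add: iso_class_simps iso.nat_pow_pow)
    then show ?thesis
      using a unfolding ideal_radical_def by blast
  qed
  ultimately show ?thesis
    unfolding radical_thick_tensor_ideal_def by blast
qed

section \<open>Principal radical ideals, intersections and quotients of radical ideals\<close>

lemma radical_eq: "radical T a = ideal_radical (generated_ideal T a)"
  by (simp add: radical_def ideal_radical_def)

lemma radical_closed: "a \<in> Obj T \<Longrightarrow> radical_thick_tensor_ideal T (radical T a)"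
  by (simp add: radical_eq radical_ideal_radical thick_generated_ideal)

text \<open>Thus \<open>radical T a\<close> is the least radical ideal containing \<open>a\<close>.
  With a suitable \<open>J\<close>, this extends a property from \<open>a\<close> to all objects of
  its radical.\<close>

lemma radical_subset_iff:
  assumes "radical_thick_tensor_ideal T J" "a \<in> Obj T"
  shows "radical T a \<subseteq> J \<longleftrightarrow> a \<in> J"
proof
  assume "a \<in> J"
  then have "generated_ideal T a \<subseteq> J"
    using assms unfolding generated_ideal_def radical_thick_tensor_ideal_def by blast
  then show "radical T a \<subseteq> J"
    using assms unfolding radical_def radical_thick_tensor_ideal_def by blast
next
  assume "radical T a \<subseteq> J"
  then show "a \<in> J"
    using subset_ideal_radical thick_generated_ideal assms(2) radical_eq by blast
qed

lemma radical_Obj: "radical_thick_tensor_ideal T (Obj T)"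
  using thick_tensor_ideal_Obj by (simp add: radical_thick_tensor_ideal_def)

lemma radical_Inter:
  assumes "\<And>I. I \<in> A \<Longrightarrow> radical_thick_tensor_ideal T I" "A \<noteq> {}"
  shows "radical_thick_tensor_ideal T (\<Inter>A)"
  using assms thick_tensor_ideal_Inter[of A] unfolding radical_thick_tensor_ideal_def by blast

lemma radical_thick: "radical_thick_tensor_ideal T I \<Longrightarrow> thick_tensor_ideal T I"
  by (simp add: radical_thick_tensor_ideal_def)

lemma radical_square_mem:
  assumes I: "radical_thick_tensor_ideal T I" and "a \<in> Obj T" "a \<otimes>\<^sub>o a \<in> I"
  shows "a \<in> I"
proof -
  have "tensor_power T a 2 \<in> I"
    using assms ideal_cong[OF radical_thick[OF I], of "a \<otimes>\<^sub>o a" "tensor_power T a 2"]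
    by (simp add: iso_class_simps numeral_2_eq_2)
  then show ?thesis
    using assms unfolding radical_thick_tensor_ideal_def by blast
qed

text \<open>If \<open>x \<otimes> a^n\<close> lies in \<open>I\<close>, multiply it by
  \<open>a \<otimes> x^n\<close>: up to order of the factors, the result is the power of
  \<open>x \<otimes> a\<close> with exponent \<open>n + 1\<close>, and radicality of
  \<open>I\<close> applies.\<close>

lemma radical_ideal_quotient:
  assumes R: "radical_thick_tensor_ideal T I" and x: "x \<in> Obj T"
  shows "radical_thick_tensor_ideal T (ideal_quotient I x)"
proof -
  note I = radical_thick[OF R]
  have "a \<in> ideal_quotient I x" if a: "a \<in> Obj T" "tensor_power T a n \<in> ideal_quotient I x" for a n
  proof -
    let ?u = "a \<otimes>\<^sub>o tensor_power T x n" and ?v = "x \<otimes>\<^sub>o tensor_power T a n"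
    have "?u \<otimes>\<^sub>o ?v \<in> I"
      using a x ideal_tensor[OF I, of ?u ?v]
      by (simp add: ideal_quotient_def Tensor_obj_closed tensor_power_closed)
    then have "tensor_power T (x \<otimes>\<^sub>o a) (Suc n) \<in> I"
      using a x ideal_cong[OF I, of "?u \<otimes>\<^sub>o ?v" "tensor_power T (x \<otimes>\<^sub>o a) (Suc n)"]
      by (simp add: iso_class_simps iso.m_ac iso.nat_pow_distrib)
    then show ?thesis
      using R a x unfolding radical_thick_tensor_ideal_def ideal_quotient_def
      by (metis (lifting) Tensor_obj_closed mem_Collect_eq)
  qed
  then show ?thesis
    using thick_ideal_quotient[OF I x] unfolding radical_thick_tensor_ideal_def by blast
qed

end

section \<open>The frame of radical thick tensor ideals\<close>

context tensor_triangulated_category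
begin

lemma carrier_Zar: "carrier (Zar T) = {I. radical_thick_tensor_ideal T I}"
  and le_Zar: "I \<sqsubseteq>\<^bsub>Zar T\<^esub> J \<longleftrightarrow> I \<subseteq> J"
  by (simp_all add: Zar_def)

text \<open>It suffices to have a greatest element, \<open>Obj T\<close>, and infima of nonempty
  families, which are intersections.\<close>

lemma complete_lattice_Zar: "complete_lattice (Zar T)"
proof (rule partial_order.complete_lattice_criterion1)
  show "partial_order (Zar T)"
    by unfold_locales (auto simp: Zar_def)
  show "\<exists>I. greatest (Zar T) I (carrier (Zar T))"
    using radical_Obj ideal_Obj radical_thick
    by (auto simp: greatest_def carrier_Zar le_Zar intro!: exI[of _ "Obj T"])
next
  fix A assume "A \<subseteq> carrier (Zar T)" "A \<noteq> {}"
  then have "greatest (Zar T) (\<Inter>A) (Lower (Zar T) A)"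
    using radical_Inter[of A] by (auto simp: greatest_def Lower_def carrier_Zar le_Zar)
  then show "\<exists>I. greatest (Zar T) I (Lower (Zar T) A)" ..
qed

sublocale Zar: complete_lattice "Zar T"
  by (rule complete_lattice_Zar)

lemma Zar_meet:
  assumes "radical_thick_tensor_ideal T I" "radical_thick_tensor_ideal T J"
  shows "I \<sqinter>\<^bsub>Zar T\<^esub> J = I \<inter> J"
proof -
  have IJ: "I \<in> carrier (Zar T)" "J \<in> carrier (Zar T)" "I \<inter> J \<in> carrier (Zar T)"
    using assms radical_Inter[of "{I, J}"] by (auto simp: carrier_Zar)
  show ?thesis
    using Zar.meet_left[OF IJ(1,2)] Zar.meet_right[OF IJ(1,2)] Zar.meet_le[OF _ _ IJ]
    by (auto simp: le_Zar)
qed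

text \<open>Joins are handled only through this universal property; no elementwise description of
  them is used.\<close>

lemma Zar_sup_le:
  assumes "A \<subseteq> carrier (Zar T)" "radical_thick_tensor_ideal T J"
  shows "\<Squnion>\<^bsub>Zar T\<^esub>A \<subseteq> J \<longleftrightarrow> (\<forall>I\<in>A. I \<subseteq> J)"
  using Zar.sup_upper[OF assms(1)] Zar.sup_least[OF assms(1), of J] assms(2)
  by (auto simp: le_Zar carrier_Zar)

lemma frame_Zar: "frame (Zar T)"
proof (intro frame.intro frame_axioms.intro complete_lattice_Zar)
  fix K A assume K: "K \<in> carrier (Zar T)" and A: "A \<subseteq> carrier (Zar T)"
  let ?B = "(\<lambda>J. K \<sqinter>\<^bsub>Zar T\<^esub> J) ` A"
  have B: "?B \<subseteq> carrier (Zar T)"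
    using K A by auto
  let ?M = "\<Squnion>\<^bsub>Zar T\<^esub>?B" and ?S = "\<Squnion>\<^bsub>Zar T\<^esub>A"
  have R: "radical_thick_tensor_ideal T K" "radical_thick_tensor_ideal T ?M"
    "radical_thick_tensor_ideal T ?S" "\<And>J. J \<in> A \<Longrightarrow> radical_thick_tensor_ideal T J"
    using K A Zar.sup_closed[OF B] Zar.sup_closed[OF A] by (auto simp: carrier_Zar)
  have meet: "K \<sqinter>\<^bsub>Zar T\<^esub> ?S = K \<inter> ?S"
    by (simp add: Zar_meet R)
  have up: "K \<inter> J \<subseteq> ?M" if "J \<in> A" for J
    using that Zar.sup_upper[OF B, of "K \<sqinter>\<^bsub>Zar T\<^esub> J"] R by (simp add: le_Zar Zar_meet)
  have "K \<inter> ?S \<subseteq> ?M"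
  proof
    fix x assume x: "x \<in> K \<inter> ?S"
    then have xO: "x \<in> Obj T"
      using ideal_Obj[OF radical_thick[OF R(1)]] by blast
    have "J \<subseteq> ideal_quotient ?M x" if J: "J \<in> A" for J
    proof
      fix y assume y: "y \<in> J"
      then have yO: "y \<in> Obj T"
        using ideal_Obj radical_thick R(4) J by blast
      have "x \<otimes>\<^sub>o y \<in> K \<inter> J"
        using ideal_tensor'[OF radical_thick[OF R(1)] yO] x y
          ideal_tensor[OF radical_thick[OF R(4)[OF J]] xO] by blast
      then show "y \<in> ideal_quotient ?M x"
        using up[OF J] yO by (auto simp: ideal_quotient_def)
    qed
    \<comment> \<open>The quotient is a radical ideal above every member of \<open>A\<close>, hence
      above the join; the next step applies this to \<open>x\<close> itself.\<close>
    then have "?S \<subseteq> ideal_quotient ?M x"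
      using Zar_sup_le[OF A] radical_ideal_quotient[OF R(2) xO] by blast
    then have "x \<otimes>\<^sub>o x \<in> ?M"
      using x by (auto simp: ideal_quotient_def)
    then show "x \<in> ?M"
      using radical_square_mem[OF R(2) xO] by blast
  qed
  moreover have "?M \<subseteq> K \<inter> ?S"
  proof -
    have "radical_thick_tensor_ideal T (K \<inter> ?S)"
      using radical_Inter[of "{K, ?S}"] R by auto
    moreover have "K \<inter> J \<subseteq> K \<inter> ?S" if "J \<in> A" for J
      using Zar.sup_upper[OF A that] by (auto simp: le_Zar)
    ultimately show ?thesis
      using Zar_sup_le[OF B] R by (auto simp: Zar_meet)
  qed
  ultimately show "K \<sqinter>\<^bsub>Zar T\<^esub> ?S = ?M"
    using meet by auto
qed

section \<open>Radicals of objects as a support with values in \<open>Zar T\<close>\<close>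

lemma radical_carrier: "a \<in> Obj T \<Longrightarrow> radical T a \<in> carrier (Zar T)"
  by (simp add: carrier_Zar radical_closed)

lemma mem_radical: "a \<in> Obj T \<Longrightarrow> a \<in> radical T a"
  using radical_subset_iff radical_closed by blast

lemma radical_mono:
  "\<lbrakk>a \<in> Obj T; b \<in> Obj T; b \<in> radical T a\<rbrakk> \<Longrightarrow> radical T b \<subseteq> radical T a"
  using radical_subset_iff radical_closed by blast

text \<open>For the harder inclusion, ideal quotients of \<open>?M\<close> are used twice: from
  \<open>a \<otimes> b\<close> one first replaces \<open>b\<close> by \<open>x\<close>, then
  \<open>a\<close> by \<open>x\<close>, and ends with \<open>x \<otimes> x\<close> in the radical
  ideal \<open>?M\<close>.\<close>

lemma radical_tensor:
  assumes o: "a \<in> Obj T" "b \<in> Obj T"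
  shows "radical T (a \<otimes>\<^sub>o b) = radical T a \<inter> radical T b"
proof
  have ab: "a \<otimes>\<^sub>o b \<in> Obj T"
    using o by (rule Tensor_obj_closed)
  let ?M = "radical T (a \<otimes>\<^sub>o b)"
  note R = radical_closed[OF ab]
  have "a \<otimes>\<^sub>o b \<in> radical T a" "a \<otimes>\<^sub>o b \<in> radical T b"
    using ideal_tensor'[OF radical_thick[OF radical_closed[OF o(1)]] o(2) mem_radical[OF o(1)]]
      ideal_tensor[OF radical_thick[OF radical_closed[OF o(2)]] o(1) mem_radical[OF o(2)]] .
  then show "?M \<subseteq> radical T a \<inter> radical T b"
    using o ab radical_mono by blast
  show "radical T a \<inter> radical T b \<subseteq> ?M"
  proof
    fix x assume x: "x \<in> radical T a \<inter> radical T b"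
    then have xO: "x \<in> Obj T"
      by (simp add: radical_def)
    have "b \<in> ideal_quotient ?M a"
      using o mem_radical[OF ab] by (simp add: ideal_quotient_def)
    then have "x \<in> ideal_quotient ?M a"
      using radical_subset_iff[OF radical_ideal_quotient[OF R o(1)] o(2)] x by blast
    then have "a \<otimes>\<^sub>o x \<in> ?M"
      by (simp add: ideal_quotient_def)
    then have "a \<in> ideal_quotient ?M x"
      using ideal_cong[OF radical_thick[OF R], of "a \<otimes>\<^sub>o x" "x \<otimes>\<^sub>o a"] o xO
      by (simp add: ideal_quotient_def iso_class_simps iso.m_comm)
    then have "x \<in> ideal_quotient ?M x"
      using radical_subset_iff[OF radical_ideal_quotient[OF R xO] o(1)] x by blast
    then show "x \<in> ?M"
      using radical_square_mem[OF R xO] by (simp add: ideal_quotient_def)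
  qed
qed

lemma radical_join_le:
  assumes "a \<in> Obj T" "b \<in> Obj T" "radical_thick_tensor_ideal T J"
  shows "radical T a \<squnion>\<^bsub>Zar T\<^esub> radical T b \<subseteq> J \<longleftrightarrow> a \<in> J \<and> b \<in> J"
  using assms Zar_sup_le[of "{radical T a, radical T b}" J]
  by (simp add: join_def radical_carrier radical_subset_iff)

lemma radical_join:
  assumes "a \<in> Obj T" "b \<in> Obj T"
  shows "radical_thick_tensor_ideal T (radical T a \<squnion>\<^bsub>Zar T\<^esub> radical T b)"
    and "a \<in> radical T a \<squnion>\<^bsub>Zar T\<^esub> radical T b" "b \<in> radical T a \<squnion>\<^bsub>Zar T\<^esub> radical T b"
proof -
  show R: "radical_thick_tensor_ideal T (radical T a \<squnion>\<^bsub>Zar T\<^esub> radical T b)"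
    using Zar.join_closed assms radical_carrier carrier_Zar by blast
  \<comment> \<open>The universal property of the join, with the join itself as upper bound.\<close>
  show "a \<in> radical T a \<squnion>\<^bsub>Zar T\<^esub> radical T b" "b \<in> radical T a \<squnion>\<^bsub>Zar T\<^esub> radical T b"
    using radical_join_le[OF assms R] by auto
qed

text \<open>Through \<open>radical_subset_iff\<close>, the axioms on suspensions, direct sums and
  triangles become closure properties of radical ideals.\<close>

lemma tt_support_radical: "tt_support T (Zar T) (radical T)"
proof (intro tt_support.intro tt_support_axioms.intro tensor_triangulated_category_axioms frame_Zar)
  fix z assume z: "zero_object T z"
  then have zO: "z \<in> Obj T"
    by (simp add: zero_object_def)
  \<comment> \<open>As a member of the carrier, the bottom is an ideal and so contains
    \<open>z\<close>.\<close>
  have "\<bottom>\<^bsub>Zar T\<^esub> \<in> carrier (Zar T)"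
    by (rule Zar.bottom_closed)
  then have "radical T z \<sqsubseteq>\<^bsub>Zar T\<^esub> \<bottom>\<^bsub>Zar T\<^esub>"
    using z zO ideal_zero radical_thick radical_subset_iff by (auto simp: le_Zar carrier_Zar)
  then show "radical T z = \<bottom>\<^bsub>Zar T\<^esub>"
    using zO radical_carrier by (intro Zar.le_antisym) auto
next
  have "J \<subseteq> radical T (Unit T)" if J: "radical_thick_tensor_ideal T J" for J
  proof
    fix x assume "x \<in> J"
    then have "x \<in> Obj T"
      using ideal_Obj radical_thick J by blast
    \<comment> \<open>The exponent 0 is the witness: the power of \<open>x\<close> is then the unit
      itself.\<close>
    then show "x \<in> radical T (Unit T)"
      using Unit_closed mem_radical thick_generated_ideal
      by (auto simp: radical_def intro!: exI[of _ 0])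
  qed
  then show "radical T (Unit T) = \<top>\<^bsub>Zar T\<^esub>"
    using radical_carrier[OF Unit_closed] Zar.top_closed Zar.top_higher
    by (intro Zar.le_antisym) (simp_all add: le_Zar carrier_Zar)
next
  fix a assume a: "a \<in> Obj T"
  note s = Susp_closed[OF a]
  show "radical T (Susp_obj T a) = radical T a"
    using radical_mono[OF a s] radical_mono[OF s a] mem_radical[OF a] mem_radical[OF s]
      ideal_Susp[OF radical_thick[OF radical_closed[OF a]] a]
      ideal_Susp[OF radical_thick[OF radical_closed[OF s]] a] by blast
next
  fix a b c assume c: "biproduct T a b c"
  then have o: "a \<in> Obj T" "b \<in> Obj T" "c \<in> Obj T"
    by (simp_all add: biproduct_def)
  note j = radical_join[OF o(1,2)] and rc = radical_closed[OF o(3)]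
  have "c \<in> radical T a \<squnion>\<^bsub>Zar T\<^esub> radical T b"
    using ideal_biproduct[OF radical_thick[OF j(1)] c j(2,3)] .
  \<comment> \<open>\<open>ideal_summand\<close> speaks of the first summand only, so the roles are
    swapped for \<open>b\<close>.\<close>
  moreover have "a \<in> radical T c" "b \<in> radical T c"
    using ideal_summand[OF radical_thick[OF rc]] c biproduct_sym[OF c] mem_radical[OF o(3)] by blast+
  ultimately show "radical T c = radical T a \<squnion>\<^bsub>Zar T\<^esub> radical T b"
    using radical_subset_iff[OF j(1) o(3)] radical_join_le[OF o(1,2) rc] by blast
next
  fix a b c f g h assume d: "distinguished T a b c f g h"
  note o = distinguished_Obj[OF d]
  note j = radical_join[OF o(1,3)]
  show "radical T b \<sqsubseteq>\<^bsub>Zar T\<^esub> radical T a \<squnion>\<^bsub>Zar T\<^esub> radical T c"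
    using ideal_middle[OF radical_thick[OF j(1)] d j(2,3)] radical_subset_iff[OF j(1) o(2)]
    by (simp add: le_Zar)
qed (simp_all add: radical_carrier radical_tensor Zar_meet radical_closed)

text \<open>Every \<open>a\<close> in \<open>J\<close> satisfies
  \<open>a \<in> radical T a \<subseteq> J\<close>. Hence a join-preserving map on
  \<open>Zar T\<close> is determined by its values on the radicals of objects.\<close>

lemma Zar_sup_radicals:
  assumes J: "radical_thick_tensor_ideal T J"
  shows "\<Squnion>\<^bsub>Zar T\<^esub>(radical T ` J) = J"
proof -
  have O: "J \<subseteq> Obj T"
    using ideal_Obj[OF radical_thick[OF J]] by blast
  then have A: "radical T ` J \<subseteq> carrier (Zar T)"
    using radical_carrier by blast
  have "J \<subseteq> \<Squnion>\<^bsub>Zar T\<^esub>(radical T ` J)"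
    using Zar.sup_upper[OF A] mem_radical O by (force simp: le_Zar)
  moreover have "\<Squnion>\<^bsub>Zar T\<^esub>(radical T ` J) \<subseteq> J"
    using Zar_sup_le[OF A J] radical_subset_iff[OF J] O by auto
  ultimately show ?thesis by blast
qed

end

section \<open>Initiality\<close>

context tt_support
begin

text \<open>The object \<open>b\<close> is a direct sum of \<open>a\<close> and a zero object, and
  the latter contributes only the bottom.\<close>

lemma supp_isomorphic:
  assumes "isomorphic T a b"
  shows "d a = d b"
proof -
  obtain z where z: "zero_object T z"
    using zero_object_exists by blast
  then have "d b = d a \<squnion>\<^bsub>F\<^esub> \<bottom>\<^bsub>F\<^esub>"
    using supp_biproduct[OF biproduct_zero_object[OF assms z]] supp_zero by simp
  moreover have "\<dots> = d a"
    using F.weak.bottom_join[of "d a"] supp_closed isomorphic_Obj[OF assms] 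
    by (simp add: F.eq_is_equal join_comm)
  ultimately show ?thesis by simp
qed

section \<open>Radical ideals cut out by a support\<close>

definition supp_ideal :: "'f \<Rightarrow> 'o set" where
  "supp_ideal f = {a \<in> Obj T. d a \<sqsubseteq>\<^bsub>F\<^esub> f}"

text \<open>For positive \<open>n\<close> the two sides agree; for \<open>n = 0\<close> the right
  side is the top. The inequality covers both cases and is what makes \<open>supp_ideal f\<close>
  radical.\<close>

lemma supp_power: "a \<in> Obj T \<Longrightarrow> d a \<sqsubseteq>\<^bsub>F\<^esub> d (tensor_power T a n)"
proof (induction n)
  case 0
  then show ?case using supp_closed by (simp add: supp_Unit)
next
  case (Suc n)
  then show ?case
    by (simp add: supp_Tensor tensor_power_closed F.weak.meet_le supp_closed)
qed

lemma radical_supp_ideal: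
  assumes f: "f \<in> carrier F"
  shows "radical_thick_tensor_ideal T (supp_ideal f)"
proof -
  have join: "d x \<sqsubseteq>\<^bsub>F\<^esub> f" if "d x \<sqsubseteq>\<^bsub>F\<^esub> d a \<squnion>\<^bsub>F\<^esub> d b" "d a \<sqsubseteq>\<^bsub>F\<^esub> f" "d b \<sqsubseteq>\<^bsub>F\<^esub> f"
    "x \<in> Obj T" "a \<in> Obj T" "b \<in> Obj T" for x a b
    using F.le_trans[OF that(1) F.weak.join_le[OF that(2,3)]] that f supp_closed by auto
  have "thick_tensor_ideal T (supp_ideal f)"
  proof (rule thick_tensor_idealI)
    fix z assume "zero_object T z"
    then show "z \<in> supp_ideal f"
      using f supp_zero by (simp add: supp_ideal_def zero_object_def)
  next
    fix a b assume "a \<in> supp_ideal f" "isomorphic T a b"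
    then show "b \<in> supp_ideal f"
      using supp_isomorphic isomorphic_Obj by (simp add: supp_ideal_def)
  next
    fix a assume "a \<in> Obj T"
    then show "Susp_obj T a \<in> supp_ideal f \<longleftrightarrow> a \<in> supp_ideal f"
      by (simp add: supp_ideal_def supp_Susp Susp_closed)
  next
    fix a b c g h k assume *: "distinguished T a b c g h k" "a \<in> supp_ideal f" "b \<in> supp_ideal f"
    \<comment> \<open>The axiom on triangles bounds the middle vertex, so the triangle is rotated
      until \<open>c\<close> is in the middle.\<close>
    then obtain l where "distinguished T b c (Susp_obj T a) h k l"
      using distinguished_rotate by blast
    then have "d c \<sqsubseteq>\<^bsub>F\<^esub> d b \<squnion>\<^bsub>F\<^esub> d a"
      using supp_triangle supp_Susp distinguished_Obj[OF *(1)] by metis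
    then show "c \<in> supp_ideal f"
      using join * distinguished_Obj[OF *(1)] by (simp add: supp_ideal_def)
  next
    fix a b c assume *: "biproduct T a b c" "a \<in> supp_ideal f" "b \<in> supp_ideal f"
    then have o: "a \<in> Obj T" "b \<in> Obj T" "c \<in> Obj T"
      by (simp_all add: biproduct_def)
    then show "c \<in> supp_ideal f"
      using * f supp_biproduct F.weak.join_le supp_closed by (simp add: supp_ideal_def)
  next
    fix a b c assume *: "biproduct T a b c" "c \<in> supp_ideal f"
    then have o: "a \<in> Obj T" "b \<in> Obj T" "c \<in> Obj T"
      by (simp_all add: biproduct_def)
    then have "d a \<sqsubseteq>\<^bsub>F\<^esub> d c"
      using supp_biproduct[OF *(1)] F.weak.join_left supp_closed by simp
    then show "a \<in> supp_ideal f"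
      using * f o F.le_trans[of "d a" "d c" f] supp_closed by (simp add: supp_ideal_def)
  next
    fix a b assume *: "a \<in> Obj T" "b \<in> supp_ideal f"
    then have "b \<in> Obj T" "d (a \<otimes>\<^sub>o\<^bsub>T\<^esub> b) \<sqsubseteq>\<^bsub>F\<^esub> d b"
      using F.weak.meet_right supp_closed supp_Tensor by (simp_all add: supp_ideal_def)
    then show "a \<otimes>\<^sub>o\<^bsub>T\<^esub> b \<in> supp_ideal f"
      using * f F.le_trans[of "d (a \<otimes>\<^sub>o\<^bsub>T\<^esub> b)" "d b" f] supp_closed
      by (simp add: supp_ideal_def Tensor_obj_closed)
  qed (auto simp: supp_ideal_def)
  moreover have "a \<in> supp_ideal f" if "a \<in> Obj T" "tensor_power T a n \<in> supp_ideal f" for a n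
    using that f F.le_trans[OF supp_power, of a n f] supp_closed tensor_power_closed
    by (simp add: supp_ideal_def)
  ultimately show ?thesis
    unfolding radical_thick_tensor_ideal_def by blast
qed

text \<open>The restriction to the carrier makes the map extensional, as \<open>frame_map\<close>
  demands; uniqueness as a HOL function depends on it.\<close>

definition supp_map :: "'o set \<Rightarrow> 'f" where
  "supp_map = restrict (\<lambda>J. \<Squnion>\<^bsub>F\<^esub>(d ` J)) (carrier (Zar T))"

lemma supp_image: "radical_thick_tensor_ideal T J \<Longrightarrow> d ` J \<subseteq> carrier F"
  using supp_closed ideal_Obj radical_thick by blast

lemma supp_map_eq: "radical_thick_tensor_ideal T J \<Longrightarrow> supp_map J = \<Squnion>\<^bsub>F\<^esub>(d ` J)"
  by (simp add: supp_map_def carrier_Zar)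

lemma supp_map_closed: "radical_thick_tensor_ideal T J \<Longrightarrow> supp_map J \<in> carrier F"
  by (simp add: supp_map_eq supp_image)

text \<open>This is the adjunction between \<open>supp_map\<close> and \<open>supp_ideal\<close>;
  monotonicity and preservation of joins are deduced from it.\<close>

lemma supp_map_le_iff:
  assumes J: "radical_thick_tensor_ideal T J" and f: "f \<in> carrier F"
  shows "supp_map J \<sqsubseteq>\<^bsub>F\<^esub> f \<longleftrightarrow> J \<subseteq> supp_ideal f"
proof
  assume le: "supp_map J \<sqsubseteq>\<^bsub>F\<^esub> f"
  show "J \<subseteq> supp_ideal f"
  proof
    fix a assume a: "a \<in> J"
    then have "d a \<sqsubseteq>\<^bsub>F\<^esub> supp_map J"
      using F.weak.sup_upper[OF supp_image[OF J]] J by (simp add: supp_map_eq)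
    then show "a \<in> supp_ideal f"
      using F.le_trans[OF _ le] a J f supp_map_closed supp_image[OF J] ideal_Obj[OF radical_thick[OF J] a]
      by (auto simp: supp_ideal_def)
  qed
next
  assume "J \<subseteq> supp_ideal f"
  then have "\<And>x. x \<in> d ` J \<Longrightarrow> x \<sqsubseteq>\<^bsub>F\<^esub> f"
    by (auto simp: supp_ideal_def)
  then show "supp_map J \<sqsubseteq>\<^bsub>F\<^esub> f"
    using F.weak.sup_least[OF supp_image[OF J] f] J by (simp add: supp_map_eq)
qed

text \<open>No object of \<open>radical T a\<close> has support beyond \<open>d a\<close>, since
  \<open>supp_ideal (d a)\<close> is a radical ideal containing \<open>a\<close>; the bound is
  attained at \<open>a\<close>.\<close>

lemma supp_map_radical:
  assumes a: "a \<in> Obj T"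
  shows "supp_map (radical T a) = d a"
proof (rule F.le_antisym)
  note R = radical_closed[OF a]
  have "a \<in> supp_ideal (d a)"
    using a supp_closed by (simp add: supp_ideal_def)
  then show "supp_map (radical T a) \<sqsubseteq>\<^bsub>F\<^esub> d a"
    using supp_map_le_iff[OF R] radical_subset_iff[OF radical_supp_ideal a] a supp_closed by blast
  show "d a \<sqsubseteq>\<^bsub>F\<^esub> supp_map (radical T a)"
    using F.weak.sup_upper[OF supp_image[OF R]] mem_radical[OF a] R by (simp add: supp_map_eq)
qed (use a supp_closed supp_map_closed radical_closed in auto)

text \<open>The usual argument that left adjoints preserve joins: both inequalities are moved to
  \<open>Zar T\<close> by \<open>supp_map_le_iff\<close>.\<close>

lemma supp_map_sup:
  assumes A: "A \<subseteq> carrier (Zar T)"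
  shows "supp_map (\<Squnion>\<^bsub>Zar T\<^esub>A) = \<Squnion>\<^bsub>F\<^esub>(supp_map ` A)"
proof (rule F.le_antisym)
  have R: "\<And>J. J \<in> A \<Longrightarrow> radical_thick_tensor_ideal T J" "radical_thick_tensor_ideal T (\<Squnion>\<^bsub>Zar T\<^esub>A)"
    using A Zar.sup_closed[OF A] by (auto simp: carrier_Zar)
  then have B: "supp_map ` A \<subseteq> carrier F"
    using supp_map_closed by blast
  let ?f = "\<Squnion>\<^bsub>F\<^esub>(supp_map ` A)"
  show f: "?f \<in> carrier F" "supp_map (\<Squnion>\<^bsub>Zar T\<^esub>A) \<in> carrier F"
    using B supp_map_closed[OF R(2)] by simp_all
  have "J \<subseteq> supp_ideal ?f" if "J \<in> A" for J
    using supp_map_le_iff[OF R(1)[OF that] f(1)] F.weak.sup_upper[OF B] that by blast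
  then show "supp_map (\<Squnion>\<^bsub>Zar T\<^esub>A) \<sqsubseteq>\<^bsub>F\<^esub> ?f"
    using supp_map_le_iff[OF R(2) f(1)] Zar_sup_le[OF A radical_supp_ideal[OF f(1)]] by blast
  let ?g = "supp_map (\<Squnion>\<^bsub>Zar T\<^esub>A)"
  have "\<Squnion>\<^bsub>Zar T\<^esub>A \<subseteq> supp_ideal ?g"
    using supp_map_le_iff[OF R(2) f(2)] f(2) by simp
  then have "supp_map J \<sqsubseteq>\<^bsub>F\<^esub> ?g" if "J \<in> A" for J
    using supp_map_le_iff[OF R(1)[OF that] f(2)] that Zar_sup_le[OF A radical_supp_ideal[OF f(2)]]
    by blast
  then show "?f \<sqsubseteq>\<^bsub>F\<^esub> ?g"
    using F.weak.sup_least[OF B f(2)] by blast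
qed

lemma supp_map_mono:
  assumes "radical_thick_tensor_ideal T I" "radical_thick_tensor_ideal T J" "I \<subseteq> J"
  shows "supp_map I \<sqsubseteq>\<^bsub>F\<^esub> supp_map J"
  using assms supp_map_le_iff[of I "supp_map J"] supp_map_le_iff[of J "supp_map J"] supp_map_closed[of J]
  by auto

lemma supp_map_meet:
  assumes I: "radical_thick_tensor_ideal T I" and J: "radical_thick_tensor_ideal T J"
  shows "supp_map (I \<inter> J) = supp_map I \<sqinter>\<^bsub>F\<^esub> supp_map J"
proof (rule F.le_antisym)
  have IJ: "radical_thick_tensor_ideal T (I \<inter> J)"
    using radical_Inter[of "{I, J}"] I J by auto
  let ?f = "supp_map (I \<inter> J)"
  note c = supp_map_closed[OF I] supp_map_closed[OF J] supp_map_closed[OF IJ]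
  show "?f \<in> carrier F" "supp_map I \<sqinter>\<^bsub>F\<^esub> supp_map J \<in> carrier F"
    using c by simp_all
  show "?f \<sqsubseteq>\<^bsub>F\<^esub> supp_map I \<sqinter>\<^bsub>F\<^esub> supp_map J"
    using supp_map_mono[OF IJ I] supp_map_mono[OF IJ J] c by (simp add: F.weak.meet_le)
  have meet: "d a \<sqinter>\<^bsub>F\<^esub> d b \<sqsubseteq>\<^bsub>F\<^esub> ?f" if a: "a \<in> I" and b: "b \<in> J" for a b
  proof -
    have o: "a \<in> Obj T" "b \<in> Obj T"
      using ideal_Obj radical_thick I J a b by blast+
    \<comment> \<open>Each of the two ideals absorbs the factor coming from the other.\<close>
    then have "a \<otimes>\<^sub>o\<^bsub>T\<^esub> b \<in> I \<inter> J"
      using ideal_tensor'[OF radical_thick[OF I]] ideal_tensor[OF radical_thick[OF J]] a b by blast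
    then have "d (a \<otimes>\<^sub>o\<^bsub>T\<^esub> b) \<sqsubseteq>\<^bsub>F\<^esub> ?f"
      using F.weak.sup_upper[OF supp_image[OF IJ]] IJ by (simp add: supp_map_eq)
    then show ?thesis
      using o by (simp add: supp_Tensor)
  qed
  \<comment> \<open>Distributivity in \<open>F\<close> is applied twice: here over \<open>J\<close>
    with \<open>a\<close> fixed, then over \<open>I\<close>.\<close>
  have "d a \<sqinter>\<^bsub>F\<^esub> supp_map J \<sqsubseteq>\<^bsub>F\<^esub> ?f" if a: "a \<in> I" for a
  proof -
    have da: "d a \<in> carrier F"
      using supp_image[OF I] a by blast
    have "d a \<sqinter>\<^bsub>F\<^esub> supp_map J = \<Squnion>\<^bsub>F\<^esub>((\<lambda>y. d a \<sqinter>\<^bsub>F\<^esub> y) ` d ` J)"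
      using meet_Sup_distrib[OF da supp_image[OF J]] J by (simp add: supp_map_eq)
    also have "\<dots> \<sqsubseteq>\<^bsub>F\<^esub> ?f"
      using meet[OF a] supp_image[OF J] da c(3) by (intro F.weak.sup_least) auto
    finally show ?thesis .
  qed
  moreover have "supp_map I \<sqinter>\<^bsub>F\<^esub> supp_map J = \<Squnion>\<^bsub>F\<^esub>((\<lambda>y. supp_map J \<sqinter>\<^bsub>F\<^esub> y) ` d ` I)"
    using meet_Sup_distrib[OF c(2) supp_image[OF I]] I by (simp add: supp_map_eq meet_comm)
  ultimately show "supp_map I \<sqinter>\<^bsub>F\<^esub> supp_map J \<sqsubseteq>\<^bsub>F\<^esub> ?f"
    using supp_image[OF I] c by (auto intro!: F.weak.sup_least simp: meet_comm[of F "supp_map J"])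
qed

lemma supp_map_inf:
  assumes "finite A" "A \<subseteq> carrier (Zar T)"
  shows "supp_map (\<Sqinter>\<^bsub>Zar T\<^esub>A) = \<Sqinter>\<^bsub>F\<^esub>(supp_map ` A)"
  using assms
proof (induction A)
  case empty
  \<comment> \<open>The empty meet is the top, which is the radical of the unit, so
    \<open>d (Unit T) = \<top>\<close> settles this case.\<close>
  have "\<Sqinter>\<^bsub>Zar T\<^esub>{} = radical T (Unit T)"
    using Zar.weak_inf_empty tt_support.supp_Unit[OF tt_support_radical] by (simp add: Zar.eq_is_equal)
  then show ?case
    using supp_map_radical[OF Unit_closed] F.weak.weak_inf_empty supp_Unit by (simp add: F.eq_is_equal)
next
  case (insert J A)
  then have J: "J \<in> carrier (Zar T)" "A \<subseteq> carrier (Zar T)"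
    by auto
  have R: "radical_thick_tensor_ideal T J" "radical_thick_tensor_ideal T (\<Sqinter>\<^bsub>Zar T\<^esub>A)"
    using J Zar.inf_closed[OF J(2)] by (auto simp: carrier_Zar)
  have B: "supp_map J \<in> carrier F" "supp_map ` A \<subseteq> carrier F"
    using J supp_map_closed by (auto simp: carrier_Zar)
  have "\<Sqinter>\<^bsub>Zar T\<^esub>(insert J A) = J \<inter> \<Sqinter>\<^bsub>Zar T\<^esub>A"
    using Zar.weak_inf_insert[OF J] Zar_meet[OF R] by (simp add: Zar.eq_is_equal)
  then show ?case
    using F.weak.weak_inf_insert[OF B] supp_map_meet[OF R] insert.IH J by (simp add: F.eq_is_equal)
qed

lemma support_morphism_supp_map: "support_morphism T (Zar T) (radical T) F d supp_map"
  unfolding support_morphism_def frame_map_def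
  using frame_Zar F.frame_axioms supp_map_sup supp_map_inf supp_map_radical supp_map_closed
  by (auto simp: carrier_Zar supp_map_def)

lemma support_morphism_unique:
  assumes "support_morphism T (Zar T) (radical T) F d u"
  shows "u = supp_map"
proof
  fix J
  have u: "u \<in> carrier (Zar T) \<rightarrow>\<^sub>E carrier F"
    "\<And>A. A \<subseteq> carrier (Zar T) \<Longrightarrow> u (\<Squnion>\<^bsub>Zar T\<^esub>A) = \<Squnion>\<^bsub>F\<^esub>(u ` A)" "\<And>a. a \<in> Obj T \<Longrightarrow> u (radical T a) = d a"
    using assms unfolding support_morphism_def frame_map_def by blast+
  show "u J = supp_map J"
  proof (cases "J \<in> carrier (Zar T)")
    case True
    then have J: "radical_thick_tensor_ideal T J"
      by (simp add: carrier_Zar)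
    have O: "J \<subseteq> Obj T"
      using ideal_Obj[OF radical_thick[OF J]] by blast
    have "u J = \<Squnion>\<^bsub>F\<^esub>(u ` radical T ` J)"
      using u(2)[of "radical T ` J"] Zar_sup_radicals[OF J] O radical_carrier by auto
    also have "u ` radical T ` J = d ` J"
    proof -
      have "u (radical T x) = d x" if "x \<in> J" for x
        by (rule u(3)) (use O that in blast)
      then show ?thesis
        by (simp add: image_image)
    qed
    finally show ?thesis
      using J by (simp add: supp_map_eq)
  next
    \<comment> \<open>Off the carrier both maps are \<open>undefined\<close> by
      extensionality.\<close>
    case False
    then show ?thesis
      using u(1) by (auto simp: supp_map_def)
  qed
qed

end

theorem theorem3p2p3:
  fixes T :: "('o, 'm, 'x) tt_cat_scheme"
  assumes "tensor_triangulated_category T"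
  shows "tt_support T (Zar T) (radical T) \<and>
         (\<forall>(F :: ('f, 'y) gorder_scheme) d. tt_support T F d \<longrightarrow>
            (\<exists>!u. support_morphism T (Zar T) (radical T) F d u))"
proof (intro conjI allI impI)
  show "tt_support T (Zar T) (radical T)"
    using assms by (rule tensor_triangulated_category.tt_support_radical)
next
  fix F :: "('f, 'y) gorder_scheme" and d
  assume "tt_support T F d"
  then interpret tt_support T F d .
  show "\<exists>!u. support_morphism T (Zar T) (radical T) F d u"
    using support_morphism_supp_map support_morphism_unique by (rule ex1I)
qed

end
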